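(* Let $q\in\mathbb{C}$ with $0<|q|<1$. For generic $x,z,u\in\mathbb{C}^*$ the following five identities hold: $$z\frac{\Theta(q^2z^{2};q^6)\Theta(q^3;q^{18})}{\Theta(qz;q^6)}-\frac{\Theta(z^{2};q^6)\Theta(q^{9};q^{18})}{\Theta(q^3z;q^6)}-z\frac{\Theta(q^4z^{2};q^6)\Theta(q^{3};q^{18})}{\Theta(q^5z;q^6)}=-\frac{(q^3;q^3)_{\infty}\Theta(z^2;q^6)}{\Theta(q^3z;q^6)(q^6;q^6)_{\infty}}\cdot\frac{(q^2;q^2)_{\infty}^2}{(q;q)_{\infty}},$$ $$\frac{\Theta(q^{4}x^2;q^6)\Theta(q^{6}x^{3};q^{18})}{\Theta(q^5x;q^6)}+x^{-2}q^{3}\frac{\Theta(x^2;q^6)\Theta(x^{3};q^{18})}{\Theta(q^3x;q^6)}+x\frac{\Theta(q^{2}x^2;q^6)\Theta(q^{12}x^{3};q^{18})}{\Theta(qx;q^6)}=\frac{(q^3;q^3)_{\infty}\Theta(-x;q)}{(q^6;q^6)_{\infty}},$$ $$\frac{\Theta(z^{2};q^6)\Theta(q^{9}z^{3};q^{18})}{\Theta(z;q^6)}+q\frac{\Theta(q^{4}z^{2};q^6)\Theta(q^{3}z^{3};q^{18})}{\Theta(q^2z;q^6)}+qz\frac{\Theta(q^{2}z^{2};q^6)\Theta(q^{15}z^{3};q^{18})}{\Theta(q^4z;q^6)}=\frac{\Theta(-q;q^4)(q^3;q^3)_{\infty}\Theta(z^2;q^3)}{\Theta(z;q^{3})(q^6;q^6)_{\infty}},$$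 $$-u^{3}\frac{\Theta(q^2u^{4};q^6)\Theta(q^{15}u^{3};q^{18})}{\Theta(qu^2;q^6)}+\frac{\Theta(u^{4};q^6)\Theta(q^{9}u^{3};q^{18})}{\Theta(q^3u^2;q^6)}+u\frac{\Theta(q^4u^{4};q^6)\Theta(q^{3}u^{3};q^{18})}{\Theta(q^5u^2;q^6)}=\frac{\Theta(-u;q)\Theta(u^{3};q^6)}{(q^3;q^3)_{\infty}},$$ $$\frac{\Theta(z^{2};q^6)\Theta(q^{9}z^{6};q^{18})}{\Theta(z;q^6)}+qz^{-1}\frac{\Theta(q^{4}z^{2};q^6)\Theta(q^{3}z^{6};q^{18})}{\Theta(q^2z;q^6)}+qz^{2}\frac{\Theta(q^{2}z^{2};q^6)\Theta(q^{15}z^{6};q^{18})}{\Theta(q^4z;q^6)}=\frac{\Theta(-z;q)\Theta(q^3z^{3};q^6)}{(q^3;q^3)_{\infty}}.$$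
   Context: $\mathbb{C}^*=\mathbb{C}\setminus\{0\}$. For $Q\in\mathbb{C}$ with $0<|Q|<1$ and $x\in\mathbb{C}$, $(x;Q)_\infty=\prod_{i\ge 0}(1-Q^i x)$. For $x\in\mathbb{C}^*$, $$\Theta(x;Q)=(x;Q)_\infty(Q/x;Q)_\infty(Q;Q)_\infty=\sum_{n=-\infty}^{\infty}(-1)^nQ^{\binom n2}x^n .$$ "Generic" means that no denominator in the identity under consideration vanishes. *)

theory Defs
  imports "HOL-Analysis.Analysis"
begin

(* Meant for norm Q < 1, where the product converges; its value is 0 exactly when some
   factor is 0, since has_prod allows finitely many vanishing factors. *)
definition qpoch_inf :: "complex \<Rightarrow> complex \<Rightarrow> complex" where
  "qpoch_inf x Q = (\<Prod>i. 1 - Q ^ i * x)"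

(* Meant for x \<noteq> 0 and 0 < norm Q < 1. *)
definition Theta :: "complex \<Rightarrow> complex \<Rightarrow> complex" where
  "Theta x Q = qpoch_inf x Q * qpoch_inf (Q / x) Q * qpoch_inf Q Q"

end

theory Submission
  imports Defs "HOL-Complex_Analysis.Complex_Analysis"
begin

text \<open>
  Both sides of every identity are, up to an apparent denominator, holomorphic functions on the
  punctured plane that are multiplied by the same elementary factor when the variable is multiplied
  by a power of \<open>q\<close>.  Two such functions are proportional as soon as the first vanishes at the
  zeros of the second and these zeros are simple: the quotient then extends to a holomorphic
  function on the punctured plane that is invariant under \<open>z \<mapsto> p z\<close>, hence bounded, hence constant by
  Liouville's theorem (\<open>quasi_periodic_proportional\<close>).  The zeros of theta functions are powers of the
  nome and all are simple, so every proof by this principle amounts to finitely many evaluations.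

  The denominators are removed by the quintuple product identity (\<open>quintuple_product\<close>), which says
  that \<open>Theta (z\<^sup>2) P / Theta z P\<close> is a sum of two theta functions with nome \<open>P ^ 3\<close>.  Calling this sum
  \<open>quint z P\<close>, all quotients in the theorem are monomial multiples of \<open>quint (q ^ k * z) (q ^ 6)\<close>.

  After this reduction the first identity is linear in theta functions of \<open>z ^ 3\<close>, and it follows by
  comparing coefficients, together with the evaluation of \<open>quint q (q ^ 6)\<close> as an eta quotient
  (\<open>quint_base6\<close>).  In the second, fourth and fifth identity the substitution \<open>z \<mapsto> q\<^sup>2 z\<close> permutes the
  three summands on the left up to a common factor.  Hence the principle above applies with
  \<open>p = q\<^sup>2\<close>, and modulo powers of \<open>p\<close> the right-hand sides have only the zeros \<open>-1\<close>, \<open>-q\<close> and, in the last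
  two cases, the numbers \<open>\<zeta>\<close> or \<open>q \<zeta>\<close> with \<open>\<zeta> ^ 3 = 1\<close>.  At each of these either the summands cancel by
  the reflection \<open>z \<mapsto> q ^ 6 / z\<close>, or the quintuple expansion gives the cancellation.  One further
  evaluation yields the constant of proportionality.  The third identity has no such symmetry, but
  after expanding \<open>quint\<close> on both sides it splits into the coefficients of \<open>1\<close> and of \<open>z\<close>
  over the functions of \<open>z ^ 3\<close>.  The equation for each coefficient follows from a three-term relation
  of Weierstrass type (\<open>Theta_three_term\<close>).
\<close>

section \<open>Infinite products\<close>

lemma convergent_prod_qpoch:
  assumes "norm Q < 1"
  shows "convergent_prod (\<lambda>i. 1 - Q ^ i * (x::complex))"
proof -
  have "summable (\<lambda>i. norm (- (Q ^ i * x)))"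
    using assms by (auto simp: norm_mult norm_power intro!: summable_mult2 summable_geometric)
  hence "abs_convergent_prod (\<lambda>i. 1 + (- (Q ^ i * x)))"
    by (subst abs_convergent_prod_conv_summable) simp
  thus ?thesis
    by (simp add: abs_convergent_prod_imp_convergent_prod)
qed

lemma has_prod_qpoch:
  assumes "norm Q < 1"
  shows "(\<lambda>i. 1 - Q ^ i * x) has_prod qpoch_inf x Q"
  unfolding qpoch_inf_def using convergent_prod_qpoch[OF assms] by blast

lemma tendsto_qpoch:
  assumes "norm Q < 1"
  shows "(\<lambda>n. \<Prod>i<n. 1 - Q ^ i * x) \<longlonglongrightarrow> qpoch_inf x Q"
  using has_prod_imp_tendsto'[OF has_prod_qpoch[OF assms]] .

lemma qpoch_eq_0_iff:
  assumes "norm Q < 1"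
  shows "qpoch_inf x Q = 0 \<longleftrightarrow> (\<exists>i. Q ^ i * x = 1)"
  using has_prod_eq_0_iff[OF has_prod_qpoch[OF assms, of x]] by (auto simp: image_iff)

lemma qpoch_self_nonzero:
  assumes "norm Q < 1"
  shows "qpoch_inf Q Q \<noteq> 0"
proof
  assume "qpoch_inf Q Q = 0"
  then obtain i where "Q ^ i * Q = 1"
    using qpoch_eq_0_iff[OF assms] by blast
  hence "norm Q ^ Suc i = 1"
    by (metis norm_one norm_power power_Suc2)
  moreover have "norm Q ^ Suc i < 1"
    using assms by (simp add: power_less_one_iff del: power_Suc)
  ultimately show False by simp
qed

lemma qpoch_head:
  assumes "norm Q < 1"
  shows "qpoch_inf x Q = (1 - x) * qpoch_inf (Q * x) Q"
proof -
  have "(\<lambda>n. \<Prod>i<Suc n. 1 - Q ^ i * x) \<longlonglongrightarrow> qpoch_inf x Q"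
    using tendsto_qpoch[OF assms] by (rule LIMSEQ_Suc)
  also have "(\<lambda>n. \<Prod>i<Suc n. 1 - Q ^ i * x) = (\<lambda>n. (1 - x) * (\<Prod>i<n. 1 - Q ^ i * (Q * x)))"
    by (subst prod.lessThan_Suc_shift) (simp add: mult_ac)
  finally show ?thesis
    using LIMSEQ_unique tendsto_mult[OF tendsto_const tendsto_qpoch[OF assms]] by blast
qed

lemma qpoch_square:
  assumes "norm Q < 1"
  shows "qpoch_inf (x\<^sup>2) (Q\<^sup>2) = qpoch_inf x Q * qpoch_inf (- x) Q"
proof -
  have "qpoch_inf x Q * qpoch_inf (- x) Q = (\<Prod>i. (1 - Q ^ i * x) * (1 - Q ^ i * (- x)))"
    unfolding qpoch_inf_def by (intro prodinf_mult convergent_prod_qpoch assms)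
  also have "\<dots> = qpoch_inf (x\<^sup>2) (Q\<^sup>2)"
    unfolding qpoch_inf_def
    by (rule arg_cong[where f = prodinf]) (auto simp: algebra_simps power2_eq_square power_mult_distrib)
  finally show ?thesis ..
qed

text \<open>
  Grouping the factors by the residue of the exponent modulo \<open>k\<close> is legitimate because it is exact
  for the partial products with \<open>n * k\<close> factors.
\<close>

lemma qpoch_dissect:
  assumes "norm Q < 1" and "0 < k"
  shows "qpoch_inf x Q = (\<Prod>j<k. qpoch_inf (Q ^ j * x) (Q ^ k))"
proof -
  have Qk: "norm (Q ^ k) < 1"
    using assms by (simp add: norm_power power_less_one_iff)
  have "(\<Prod>j<k. \<Prod>i<n. 1 - (Q ^ k) ^ i * (Q ^ j * x)) = (\<Prod>i<n * k. 1 - Q ^ i * x)" for n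
  proof -
    have "(\<Prod>i<n * k. 1 - Q ^ i * x) = (\<Prod>i<n. \<Prod>j = i * k..<i * k + k. 1 - Q ^ j * x)"
      by (rule prod.nat_group [symmetric])
    also have "\<dots> = (\<Prod>i<n. \<Prod>j<k. 1 - (Q ^ k) ^ i * (Q ^ j * x))"
    proof (rule prod.cong[OF refl])
      fix i
      have "(\<Prod>j = i * k..<i * k + k. 1 - Q ^ j * x) = (\<Prod>j = 0 + i * k..<k + i * k. 1 - Q ^ j * x)"
        by (simp add: add.commute)
      also have "\<dots> = (\<Prod>j<k. 1 - Q ^ (j + i * k) * x)"
        by (subst prod.shift_bounds_nat_ivl) (simp add: atLeast0LessThan)
      also have "\<dots> = (\<Prod>j<k. 1 - (Q ^ k) ^ i * (Q ^ j * x))"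
        by (simp add: power_add power_mult [symmetric] mult_ac)
      finally show "(\<Prod>j = i * k..<i * k + k. 1 - Q ^ j * x) = \<dots>" .
    qed
    finally show ?thesis
      by (simp add: prod.swap[of _ "{..<n}"])
  qed
  moreover have "(\<lambda>n. \<Prod>j<k. \<Prod>i<n. 1 - (Q ^ k) ^ i * (Q ^ j * x))
      \<longlonglongrightarrow> (\<Prod>j<k. qpoch_inf (Q ^ j * x) (Q ^ k))"
    by (intro tendsto_prod tendsto_qpoch Qk)
  moreover have "(\<lambda>n. \<Prod>i<n * k. 1 - Q ^ i * x) \<longlonglongrightarrow> qpoch_inf x Q"
    using filterlim_compose[OF tendsto_qpoch[OF assms(1)] mult_nat_right_at_top[OF assms(2)]] .
  ultimately show ?thesis
    using LIMSEQ_unique by simp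
qed

lemma qpoch_dissect2:
  assumes "norm Q < 1"
  shows "qpoch_inf x Q = qpoch_inf x (Q\<^sup>2) * qpoch_inf (Q * x) (Q\<^sup>2)"
  using qpoch_dissect[OF assms, of 2 x] by (simp add: numeral_2_eq_2)

lemma qpoch_dissect3:
  assumes "norm Q < 1"
  shows "qpoch_inf x Q = qpoch_inf x (Q ^ 3) * qpoch_inf (Q * x) (Q ^ 3) * qpoch_inf (Q\<^sup>2 * x) (Q ^ 3)"
proof -
  have "{..<3} = {0, 1, 2 :: nat}"
    by auto
  thus ?thesis
    using qpoch_dissect[OF assms, of 3 x] by (simp add: mult_ac)
qed

lemma holomorphic_qpoch_UNIV:
  assumes "norm Q < 1"
  shows "(\<lambda>x. qpoch_inf x Q) holomorphic_on UNIV"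
proof (rule holomorphic_uniform_sequence)
  fix z :: complex
  have "uniformly_convergent_on (cball z 1) (\<lambda>N x. \<Prod>n<N. 1 - Q ^ n * x)"
  proof (rule uniformly_convergent_on_prod')
    show "uniformly_convergent_on (cball z 1) (\<lambda>N x. \<Sum>n<N. norm (1 - Q ^ n * x - 1))"
    proof (rule Weierstrass_m_test')
      fix n x assume "x \<in> cball z 1"
      hence "norm x \<le> norm z + 1"
        using norm_triangle_sub[of x z] by (simp add: dist_norm norm_minus_commute)
      thus "norm (norm (1 - Q ^ n * x - 1)) \<le> norm Q ^ n * (norm z + 1)"
        by (simp add: norm_mult norm_power mult_left_mono)
    next
      show "summable (\<lambda>n. norm Q ^ n * (norm z + 1))"
        using assms by (intro summable_mult2 summable_geometric) auto
    qed
  qed (auto intro!: continuous_intros)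
  then obtain l where l: "uniform_limit (cball z 1) (\<lambda>N x. \<Prod>n<N. 1 - Q ^ n * x) l sequentially"
    by (auto simp: uniformly_convergent_on_def)
  moreover have "l x = qpoch_inf x Q" if "x \<in> cball z 1" for x
    using tendsto_uniform_limitI[OF l that] tendsto_qpoch[OF assms] LIMSEQ_unique by blast
  ultimately have "uniform_limit (cball z 1) (\<lambda>N x. \<Prod>n<N. 1 - Q ^ n * x) (\<lambda>x. qpoch_inf x Q) sequentially"
    by (subst (asm) uniform_limit_cong'[where f = "\<lambda>N x. \<Prod>n<N. 1 - Q ^ n * x" and g = "\<lambda>N x. \<Prod>n<N. 1 - Q ^ n * x" and i = "\<lambda>x. qpoch_inf x Q"]) auto
  thus "\<exists>d>0. cball z d \<subseteq> UNIV \<and>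
      uniform_limit (cball z d) (\<lambda>N x. \<Prod>n<N. 1 - Q ^ n * x) (\<lambda>x. qpoch_inf x Q) sequentially"
    by (intro exI[of _ 1]) auto
qed (auto intro!: holomorphic_intros)

lemma holomorphic_qpoch:
  assumes "norm Q < 1" "g holomorphic_on A"
  shows "(\<lambda>z. qpoch_inf (g z) Q) holomorphic_on A"
  using holomorphic_on_compose[OF assms(2) holomorphic_on_subset[OF holomorphic_qpoch_UNIV[OF assms(1)]]]
  by (simp add: o_def)

section \<open>The theta function\<close>

lemma Theta_shift:
  assumes "norm Q < 1" "Q \<noteq> 0" "x \<noteq> 0"
  shows "Theta (Q * x) Q = - Theta x Q / x"
proof -
  have "qpoch_inf (1 / x) Q = (1 - 1 / x) * qpoch_inf (Q / x) Q"
    using qpoch_head[OF assms(1), of "1 / x"] by simp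
  moreover have "qpoch_inf x Q = (1 - x) * qpoch_inf (Q * x) Q"
    by (rule qpoch_head[OF assms(1)])
  moreover have "Q / (Q * x) = 1 / x"
    using assms by simp
  moreover have "(1 - 1 / x) * x = - (1 - x)"
    using assms(3) by (simp add: field_simps)
  ultimately have "Theta (Q * x) Q * x = - Theta x Q"
    unfolding Theta_def by (metis (no_types, opaque_lifting) mult.assoc mult.commute mult_minus_left)
  thus ?thesis
    using assms(3) by (simp add: field_simps)
qed

lemma Theta_reflect:
  assumes "Q \<noteq> 0"
  shows "Theta (Q / x) Q = Theta x Q"
  using assms by (simp add: Theta_def)

lemma Theta_inverse:
  assumes "norm Q < 1" "Q \<noteq> 0" "x \<noteq> 0"
  shows "Theta (1 / x) Q = - Theta x Q / x"
  using Theta_shift[OF assms(1,2), of "1 / x"] Theta_reflect[OF assms(2), of x] assms(3)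
  by (simp add: field_simps)

lemma Theta_one: "norm Q < 1 \<Longrightarrow> Theta 1 Q = 0"
  by (auto simp: Theta_def qpoch_eq_0_iff intro: exI[of _ 0])

lemma Theta_eq_0_iff:
  assumes "norm Q < 1" "Q \<noteq> 0" "x \<noteq> 0"
  shows "Theta x Q = 0 \<longleftrightarrow> (\<exists>n::int. x = Q powi n)"
proof
  assume "Theta x Q = 0"
  then consider i where "Q ^ i * x = 1" | i where "Q ^ i * (Q / x) = 1"
    using qpoch_self_nonzero[OF assms(1)] assms(1) by (auto simp: Theta_def qpoch_eq_0_iff)
  thus "\<exists>n::int. x = Q powi n"
  proof cases
    case (1 i)
    hence "x = Q powi (- int i)"
      using assms by (simp add: power_int_minus field_simps)
    thus ?thesis ..
  next
    case (2 i)
    hence "x = Q powi (int (Suc i))"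
      using assms by (simp add: field_simps del: of_nat_Suc)
    thus ?thesis ..
  qed
next
  assume "\<exists>n::int. x = Q powi n"
  then obtain n :: int where "x = Q powi n" ..
  moreover have "Theta (Q powi n) Q = 0"
  proof (induction n rule: int_induct[where k = 0])
    case base
    thus ?case using assms by (simp add: Theta_one)
  next
    case (step1 i)
    thus ?case
      using Theta_shift[OF assms(1,2), of "Q powi i"] assms by (simp add: power_int_add mult_ac)
  next
    case (step2 i)
    thus ?case
      using Theta_shift[OF assms(1,2), of "Q powi (i - 1)"] assms by (simp add: power_int_diff)
  qed
  ultimately show "Theta x Q = 0" by simp
qed

lemma norm_power_int_eq_1D:
  assumes "norm (q :: complex) < 1" "q \<noteq> 0" "norm q powi n = 1"
  shows "n = 0"
  using power_int_strict_mono[of "norm q" 1 n] power_int_strict_antimono[of "norm q" 1 n] assms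
  by (cases n "0 :: int" rule: linorder_cases) auto

lemma Theta_shift_power:
  assumes "norm q < 1" "q \<noteq> 0" "w \<noteq> 0" "0 < b"
  shows "Theta (q ^ (a + b) * w) (q ^ b) = - Theta (q ^ a * w) (q ^ b) / (q ^ a * w)"
  using Theta_shift[of "q ^ b" "q ^ a * w"] assms
  by (simp add: norm_power power_less_one_iff power_add mult_ac)

lemma Theta_reflect_power:
  assumes "q \<noteq> 0" "a \<le> b"
  shows "Theta (q ^ (b - a) / w) (q ^ b) = Theta (q ^ a * w) (q ^ b)"
  using Theta_reflect[of "q ^ b" "q ^ a * w"] assms by (simp add: power_diff field_simps)

lemma Theta_dissect:
  assumes "norm Q < 1" "Q \<noteq> 0" "x \<noteq> 0"
  shows "Theta x Q * (qpoch_inf (Q\<^sup>2) (Q\<^sup>2))\<^sup>2 = qpoch_inf Q Q * (Theta x (Q\<^sup>2) * Theta (Q * x) (Q\<^sup>2))"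
proof -
  have "qpoch_inf y Q = qpoch_inf y (Q\<^sup>2) * qpoch_inf (Q * y) (Q\<^sup>2)" for y
    using qpoch_dissect[OF assms(1), of 2 y] by (simp add: numeral_2_eq_2)
  from this[of x] this[of "Q / x"] show ?thesis
    using assms by (simp add: Theta_def power2_eq_square mult_ac)
qed

text \<open>
  This is the source of every evaluation of a theta function as a single Euler product below:
  the factors of \<open>(Q; Q)\<close> with exponent congruent to 1, 2 and 0 modulo 3 are the three factors of
  the theta function.
\<close>

lemma Theta_cubed_base:
  assumes "norm Q < 1" "Q \<noteq> 0"
  shows "Theta Q (Q ^ 3) = qpoch_inf Q Q"
  using qpoch_dissect[OF assms(1), of 3 Q] assms
  by (simp add: Theta_def numeral_3_eq_3 power2_eq_square mult_ac)

lemma holomorphic_Theta [holomorphic_intros]: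
  assumes "norm Q < 1" "f holomorphic_on A" "\<And>z. z \<in> A \<Longrightarrow> f z \<noteq> 0"
  shows "(\<lambda>z. Theta (f z) Q) holomorphic_on A"
  unfolding Theta_def using assms by (intro holomorphic_intros holomorphic_qpoch) auto

text \<open>
  At 1 the factor \<open>1 - z\<close> splits off and the remaining product does not vanish. The shift relation
  carries a non-zero derivative at a zero to the two neighbouring zeros.
\<close>

lemma Theta_simple_zero:
  assumes Q: "norm Q < 1" "Q \<noteq> 0" and "x \<noteq> 0" "Theta x Q = 0"
  obtains d where "d \<noteq> 0" "((\<lambda>z. Theta z Q) has_field_derivative d) (at x)"
proof -
  obtain n :: int where n: "x = Q powi n"
    using Theta_eq_0_iff[OF Q] assms by blast
  have zero: "Theta (Q powi i) Q = 0" for i :: int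
    using Theta_eq_0_iff[OF Q] Q by auto
  have "\<exists>d. d \<noteq> 0 \<and> ((\<lambda>z. Theta z Q) has_field_derivative d) (at (Q powi n))"
  proof (induction n rule: int_induct[where k = 0])
    case base
    define H where "H = (\<lambda>z. qpoch_inf (Q * z) Q * qpoch_inf (Q / z) Q * qpoch_inf Q Q)"
    have "H holomorphic_on -{0}"
      unfolding H_def using Q by (intro holomorphic_intros holomorphic_qpoch) auto
    hence "H field_differentiable (at 1)"
      by (rule holomorphic_on_imp_differentiable_at) auto
    then obtain H' where H': "(H has_field_derivative H') (at 1)"
      by (auto simp: field_differentiable_def)
    have "Theta z Q = (1 - z) * H z" for z
      using qpoch_head[OF Q(1), of z] by (simp add: Theta_def H_def)
    moreover have "((\<lambda>z. (1 - z) * H z) has_field_derivative - H 1) (at 1)"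
      by (auto intro!: derivative_eq_intros H')
    moreover have "H 1 \<noteq> 0"
      using qpoch_self_nonzero[OF Q(1)] by (simp add: H_def)
    ultimately show ?case by (intro exI[of _ "- H 1"]) simp
  next
    case (step1 i)
    then obtain d where d: "d \<noteq> 0" "((\<lambda>z. Theta z Q) has_field_derivative d) (at (Q powi i))"
      by blast
    define y where "y = Q powi (i + 1)"
    have y: "y \<noteq> 0" "y / Q = Q powi i"
      using Q by (auto simp: y_def power_int_add)
    have "((\<lambda>z. z / Q) has_field_derivative 1 / Q) (at y)"
      using Q by (auto intro!: derivative_eq_intros)
    hence "((\<lambda>z. Theta (z / Q) Q) has_field_derivative d * (1 / Q)) (at y)"
      using d(2) unfolding y(2) [symmetric] by (rule DERIV_chain')
    hence "((\<lambda>z. - Theta (z / Q) Q / (z / Q)) has_field_derivative - d / Q / (y / Q)) (at y)"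
      using y(1) Q zero[of i, folded y(2)] by (auto intro!: derivative_eq_intros)
    moreover have ev: "eventually (\<lambda>z. - Theta (z / Q) Q / (z / Q) = Theta z Q) (nhds y)"
      using t1_space_nhds[OF y(1)]
    proof eventually_elim
      case (elim z)
      thus ?case using Theta_shift[OF Q, of "z / Q"] Q by simp
    qed
    ultimately have "((\<lambda>z. Theta z Q) has_field_derivative - d / Q / (y / Q)) (at y)"
      using DERIV_cong_ev[OF refl ev refl] by blast
    thus ?case using d y Q unfolding y_def by (intro exI[of _ "- d / Q / (y / Q)"]) (auto simp: y_def)
  next
    case (step2 i)
    then obtain d where d: "d \<noteq> 0" "((\<lambda>z. Theta z Q) has_field_derivative d) (at (Q powi i))"
      by blast
    define y where "y = Q powi (i - 1)"
    have y: "y \<noteq> 0" "Q * y = Q powi i"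
      using Q by (auto simp: y_def power_int_diff)
    have "((\<lambda>z. Q * z) has_field_derivative Q) (at y)"
      by (auto intro!: derivative_eq_intros)
    hence "((\<lambda>z. Theta (Q * z) Q) has_field_derivative d * Q) (at y)"
      using d(2) unfolding y(2) [symmetric] by (rule DERIV_chain')
    hence "((\<lambda>z. - z * Theta (Q * z) Q) has_field_derivative - y * (d * Q)) (at y)"
      using zero[of i, folded y(2)] by (auto intro!: derivative_eq_intros)
    moreover have ev: "eventually (\<lambda>z. - z * Theta (Q * z) Q = Theta z Q) (nhds y)"
      using t1_space_nhds[OF y(1)]
    proof eventually_elim
      case (elim z)
      thus ?case using Theta_shift[OF Q, of z] Q by simp
    qed
    ultimately have "((\<lambda>z. Theta z Q) has_field_derivative - y * (d * Q)) (at y)"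
      using DERIV_cong_ev[OF refl ev refl] by blast
    thus ?case using d y Q unfolding y_def by (intro exI[of _ "- y * (d * Q)"]) (auto simp: y_def)
  qed
  thus ?thesis using that n by blast
qed

lemma Theta_monom_simple_zero:
  assumes "norm Q < 1" "Q \<noteq> 0" "a \<noteq> 0" "z \<noteq> 0" "0 < k" "Theta (a * z ^ k) Q = 0"
  shows "\<exists>d. d \<noteq> 0 \<and> ((\<lambda>z. Theta (a * z ^ k) Q) has_field_derivative d) (at z)"
proof -
  have "a * z ^ k \<noteq> 0"
    using assms by simp
  then obtain d where d: "d \<noteq> 0" "((\<lambda>z. Theta z Q) has_field_derivative d) (at (a * z ^ k))"
    using Theta_simple_zero[OF assms(1,2) _ assms(6)] by blast
  have "((\<lambda>z. a * z ^ k) has_field_derivative a * (of_nat k * z ^ (k - 1))) (at z)"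
    by (auto intro!: derivative_eq_intros)
  from DERIV_chain'[OF this d(2)] show ?thesis
    using assms d(1) by (intro exI[of _ "d * (a * (of_nat k * z ^ (k - 1)))"]) simp
qed

lemma simple_zero_mult:
  fixes g h :: "complex \<Rightarrow> complex"
  assumes "\<exists>d. d \<noteq> 0 \<and> (g has_field_derivative d) (at z)" "g z = 0"
    and "h holomorphic_on -{0}" "z \<noteq> 0" "h z \<noteq> 0"
  shows "\<exists>d. d \<noteq> 0 \<and> ((\<lambda>z. g z * h z) has_field_derivative d) (at z)"
    and "\<exists>d. d \<noteq> 0 \<and> ((\<lambda>z. h z * g z) has_field_derivative d) (at z)"
proof -
  obtain d where d: "d \<noteq> 0" "(g has_field_derivative d) (at z)"
    using assms(1) by blast
  have "h field_differentiable (at z)"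
    using holomorphic_on_imp_differentiable_at[OF assms(3)] assms(4) by auto
  then obtain e where e: "(h has_field_derivative e) (at z)"
    by (auto simp: field_differentiable_def)
  have D: "((\<lambda>z. g z * h z) has_field_derivative d * h z) (at z)"
    using DERIV_mult[OF d(2) e] assms(2) by simp
  show "\<exists>d. d \<noteq> 0 \<and> ((\<lambda>z. g z * h z) has_field_derivative d) (at z)"
    using D d(1) assms(5) by (intro exI[of _ "d * h z"]) simp
  thus "\<exists>d. d \<noteq> 0 \<and> ((\<lambda>z. h z * g z) has_field_derivative d) (at z)"
    by (simp add: mult.commute)
qed

section \<open>Quasi-periodic functions\<close>

text \<open>
  The annulus \<open>norm p \<le> norm z \<le> 1\<close> contains a fundamental domain for multiplication by \<open>p\<close>.
\<close>

lemma ex_shift_into_annulus: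
  assumes "0 < norm p" "norm p < 1" "z \<noteq> (0::complex)"
  obtains n :: int where "norm (p powi n * z) \<le> 1" "norm p \<le> norm (p powi n * z)"
proof -
  define t where "t = log (norm p) (norm z)"
  have "norm (p powi (- \<lfloor>t\<rfloor>) * z) = norm p powr (t - \<lfloor>t\<rfloor>)"
  proof -
    have "norm z = norm p powr t"
      using assms by (simp add: t_def)
    moreover have "norm (p powi (- \<lfloor>t\<rfloor>)) = norm p powr (- \<lfloor>t\<rfloor>)"
      using assms by (simp add: norm_power_int powr_real_of_int' del: of_int_minus add: of_int_minus[symmetric])
    ultimately show ?thesis
      by (simp add: norm_mult powr_add [symmetric])
  qed
  moreover have "norm p powr (t - \<lfloor>t\<rfloor>) \<le> norm p powr 0"
    using assms by (intro powr_mono') auto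
  moreover have "norm p powr 1 \<le> norm p powr (t - \<lfloor>t\<rfloor>)"
    using assms by (intro powr_mono') (auto, linarith)
  ultimately show ?thesis
    using that[of "- \<lfloor>t\<rfloor>"] assms by simp
qed

text \<open>
  Zeros of a quasi-periodic function need to be located only modulo powers of \<open>p\<close>.
\<close>

lemma quasi_periodic_zero:
  assumes p: "p \<noteq> (0::complex)"
    and f: "\<And>z. z \<noteq> 0 \<Longrightarrow> f (p * z) = m z * (f z :: complex)"
    and m: "\<And>z. z \<noteq> 0 \<Longrightarrow> m z \<noteq> 0"
    and a: "a \<noteq> 0" "f a = 0"
  shows "f (a * p powi n) = 0"
proof (induction n rule: int_induct[where k = 0])
  case base
  thus ?case using a by simp
next
  case (step1 i)
  thus ?case using f[of "a * p powi i"] p a by (simp add: power_int_add mult_ac)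
next
  case (step2 i)
  have "f (a * p powi i) = m (a * p powi (i - 1)) * f (a * p powi (i - 1))"
    using f[of "a * p powi (i - 1)"] p a by (simp add: power_int_diff mult_ac)
  thus ?case using m[of "a * p powi (i - 1)"] step2 p a by auto
qed

text \<open>
  The quotient \<open>f / g\<close>, with its removable singularities filled in, is invariant under multiplication
  by \<open>p\<close>. It is bounded by its maximum over the compact annulus \<open>norm p \<le> norm z \<le> 1\<close>, and
  composing it with the exponential function turns it into a bounded entire function.
\<close>

lemma quasi_periodic_proportional:
  fixes f g m :: "complex \<Rightarrow> complex"
  assumes p: "0 < norm p" "norm p < 1"
    and hol: "f holomorphic_on -{0}" "g holomorphic_on -{0}"
    and f: "\<And>z. z \<noteq> 0 \<Longrightarrow> f (p * z) = m z * f z"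
    and g: "\<And>z. z \<noteq> 0 \<Longrightarrow> g (p * z) = m z * g z"
    and m: "\<And>z. z \<noteq> 0 \<Longrightarrow> m z \<noteq> 0"
    and simple: "\<And>z. z \<noteq> 0 \<Longrightarrow> g z = 0 \<Longrightarrow> \<exists>d. d \<noteq> 0 \<and> (g has_field_derivative d) (at z)"
    and zeros: "\<And>z. z \<noteq> 0 \<Longrightarrow> g z = 0 \<Longrightarrow> f z = 0"
  obtains c where "\<And>z. z \<noteq> 0 \<Longrightarrow> f z = c * g z"
proof -
  \<comment> \<open>By the rule of l'Hospital, the quotient of the derivatives is the value that fills the singularity.\<close>
  define h where "h = (\<lambda>z. if g z = 0 then deriv f z / deriv g z else f z / g z)"
  have p0: "p \<noteq> 0" using p by auto
  have cont: "isCont k a" if "k holomorphic_on -{0}" "a \<noteq> 0" for k :: "complex \<Rightarrow> complex" and a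
    using holomorphic_on_imp_differentiable_at[OF that(1)] that(2)
    by (intro field_differentiable_imp_continuous_at) auto
  have d0: "deriv g a \<noteq> 0" if "a \<noteq> 0" "g a = 0" for a
    using simple[OF that] by (auto dest: DERIV_imp_deriv)
  have isolated: "eventually (\<lambda>z. g z \<noteq> 0) (at a)" if "a \<noteq> 0" for a
  proof (cases "g a = 0")
    case True
    then obtain d where d: "d \<noteq> 0" "(g has_field_derivative d) (at a)"
      using simple[OF \<open>a \<noteq> 0\<close> True] by blast
    have "((\<lambda>z. (g z - g a) / (z - a)) \<longlongrightarrow> d) (at a)"
      using d(2) by (simp add: has_field_derivative_iff)
    from tendsto_imp_eventually_ne[OF this d(1)] show ?thesis
      by eventually_elim (use True in auto)
  next
    case False
    have "isCont g a"
      using cont[OF hol(2) that] .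
    hence "(g \<longlongrightarrow> g a) (at a)" by (simp add: isCont_def)
    from tendsto_imp_eventually_ne[OF this False] show ?thesis .
  qed
  have hol_h: "h holomorphic_on -{0}"
  proof -
    have "h field_differentiable (at a)" if a: "a \<noteq> 0" for a
    proof (cases "g a = 0")
      case False
      have "isCont g a"
        using cont[OF hol(2) a] .
      hence "(g \<longlongrightarrow> g a) (nhds a)"
        by (simp add: continuous_at tendsto_at_iff_tendsto_nhds)
      from tendsto_imp_eventually_ne[OF this False]
      have ev: "eventually (\<lambda>z. h z = f z / g z) (nhds a)"
        by eventually_elim (auto simp: h_def)
      have "(\<lambda>z. f z / g z) field_differentiable (at a)"
        using False hol a
        by (intro field_differentiable_divide holomorphic_on_imp_differentiable_at[of _ "-{0}"]) auto
      then obtain D where "((\<lambda>z. f z / g z) has_field_derivative D) (at a)"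
        by (auto simp: field_differentiable_def)
      hence "(h has_field_derivative D) (at a)"
        by (subst DERIV_cong_ev[OF refl ev refl])
      thus ?thesis by (auto simp: field_differentiable_def)
    next
      case True
      \<comment> \<open>Divide both functions by \<open>z - a\<close>; the new denominator does not vanish at \<open>a\<close>.\<close>
      define f1 where "f1 = (\<lambda>z. if z = a then deriv f a else (f z - f a) / (z - a))"
      define g1 where "g1 = (\<lambda>z. if z = a then deriv g a else (g z - g a) / (z - a))"
      have hol1: "f1 holomorphic_on -{0}" "g1 holomorphic_on -{0}"
        using pole_lemma_open[OF hol(1), of a] pole_lemma_open[OF hol(2), of a]
        by (simp_all add: f1_def g1_def open_Compl)
      have g1a: "g1 a \<noteq> 0" using d0[OF a True] by (simp add: g1_def)
      have "eventually (\<lambda>z. z = a \<or> g z \<noteq> 0) (nhds a)"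
        using isolated[OF a] by (auto simp: eventually_at_filter elim!: eventually_mono)
      hence ev: "eventually (\<lambda>z. h z = f1 z / g1 z) (nhds a)"
      proof eventually_elim
        case (elim z)
        thus ?case using True zeros[OF a True] by (auto simp: h_def f1_def g1_def)
      qed
      have "(\<lambda>z. f1 z / g1 z) field_differentiable (at a)"
        using g1a hol1 a
        by (intro field_differentiable_divide holomorphic_on_imp_differentiable_at[of _ "-{0}"]) auto
      then obtain D where "((\<lambda>z. f1 z / g1 z) has_field_derivative D) (at a)"
        by (auto simp: field_differentiable_def)
      hence "(h has_field_derivative D) (at a)"
        by (subst DERIV_cong_ev[OF refl ev refl])
      thus ?thesis by (auto simp: field_differentiable_def)
    qed
    thus ?thesis
      by (simp add: holomorphic_on_def field_differentiable_at_within)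
  qed
  have cont_h: "continuous_on (-{0}) h"
    using hol_h by (rule holomorphic_on_imp_continuous_on)
  \<comment> \<open>Invariance is needed only off the zeros of \<open>g\<close>; the bound passes to the zeros by continuity.\<close>
  have periodic: "g (p powi n * z) \<noteq> 0 \<and> h (p powi n * z) = h z" if "z \<noteq> 0" "g z \<noteq> 0" for z n
  proof (induction n rule: int_induct[where k = 0])
    case base
    thus ?case using that by simp
  next
    case (step1 i)
    define w where "w = p powi i * z"
    have w: "w \<noteq> 0" "p powi (i + 1) * z = p * w"
      using p0 that by (auto simp: w_def power_int_add mult_ac)
    show ?case
      unfolding w(2) using step1 f[OF w(1)] g[OF w(1)] m[OF w(1)]
      by (auto simp: w_def [symmetric] h_def)
  next
    case (step2 i)
    define w where "w = p powi (i - 1) * z"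
    have w: "w \<noteq> 0" "p powi i * z = p * w"
      using p0 that by (auto simp: w_def power_int_diff mult_ac)
    show ?case
      using step2 f[OF w(1)] g[OF w(1)] m[OF w(1)]
      by (auto simp: w_def [symmetric] w(2) h_def)
  qed
  have "compact (cball 0 1 - ball 0 (norm p) :: complex set)"
    by (intro compact_diff) auto
  moreover have "continuous_on (cball 0 1 - ball 0 (norm p)) h"
    using p by (intro continuous_on_subset[OF cont_h]) auto
  ultimately have "bounded (h ` (cball 0 1 - ball 0 (norm p)))"
    using compact_continuous_image compact_imp_bounded by blast
  then obtain B where "\<forall>z\<in>cball 0 1 - ball 0 (norm p). norm (h z) \<le> B"
    by (auto simp: bounded_iff)
  hence B: "norm (h z) \<le> B" if "norm z \<le> 1" "norm p \<le> norm z" for z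
    using that by auto
  have B': "norm (h z) \<le> B" if "z \<noteq> 0" "g z \<noteq> 0" for z
    using ex_shift_into_annulus[OF p that(1)] B periodic[OF that] by metis
  have B'': "norm (h a) \<le> B" if a: "a \<noteq> 0" for a
  proof -
    have "eventually (\<lambda>z. z \<noteq> 0) (at a)"
      using a t1_space_nhds[of a 0] by (auto simp: eventually_at_filter elim!: eventually_mono)
    with isolated[OF a] have "eventually (\<lambda>z. norm (h z) \<le> B) (at a)"
      by eventually_elim (rule B')
    moreover have "(h \<longlongrightarrow> h a) (at a)"
      using cont[OF hol_h a] by (simp add: isCont_def)
    ultimately show ?thesis
      using Lim_norm_ubound[of "at a" h "h a" B] by simp
  qed
  have "(\<lambda>w. h (exp w)) constant_on UNIV"
  proof (rule Liouville_theorem)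
    show "(\<lambda>w. h (exp w)) holomorphic_on UNIV"
    proof -
      have "exp ` UNIV \<subseteq> - {0 :: complex}"
        by (metis ComplI exp_not_eq_zero imageE singletonD subsetI)
      thus ?thesis
        using holomorphic_on_compose_gen[OF holomorphic_on_exp hol_h, of UNIV] unfolding o_def by blast
    qed
    show "bounded (range (\<lambda>w. h (exp w)))"
      by (auto simp: bounded_iff intro!: exI[of _ B] B'')
  qed
  then obtain c where c: "\<And>w. h (exp w) = c"
    by (auto simp: constant_on_def)
  have "f z = c * g z" if "z \<noteq> 0" for z
    using c[of "Ln z"] that zeros[OF that] by (auto simp: h_def split: if_splits)
  thus ?thesis by (rule that)
qed

section \<open>The quintuple product\<close>

text \<open>
  Both sides are multiplied by \<open>1 / (P z ^ 4)\<close> under \<open>z \<mapsto> P z\<close>, and the zeros of \<open>Theta (z\<^sup>2) P\<close> are,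
  modulo powers of \<open>P\<close>, the numbers \<open>1\<close>, \<open>-1\<close> and the two square roots of \<open>P\<close>. The constant is read off at a
  primitive cube root of unity, where the two theta functions of \<open>z ^ 3\<close> reduce to \<open>(P; P)\<close>.
\<close>

lemma quintuple_product:
  assumes P: "norm P < 1" "P \<noteq> 0" and "z \<noteq> 0"
  shows "qpoch_inf P P * Theta (z\<^sup>2) P
           = Theta z P * (Theta (P * z ^ 3) (P ^ 3) + z * Theta (P\<^sup>2 * z ^ 3) (P ^ 3))"
proof -
  define f where "f = (\<lambda>z. Theta z P * (Theta (P * z ^ 3) (P ^ 3) + z * Theta (P\<^sup>2 * z ^ 3) (P ^ 3)))"
  define g where "g = (\<lambda>z. Theta (z\<^sup>2) P)"
  define m where "m = (\<lambda>z. 1 / (P * z ^ 4))"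
  have P3: "norm (P ^ 3) < 1" "P ^ 3 \<noteq> 0"
    using P by (auto simp: norm_power power_less_one_iff)
  have f: "f (P * z) = m z * f z" if "z \<noteq> 0" for z
  proof -
    have "Theta (P * (P * z) ^ 3) (P ^ 3) = - Theta (P * z ^ 3) (P ^ 3) / (P * z ^ 3)"
      using Theta_shift[OF P3, of "P * z ^ 3"] P that by (simp add: power_mult_distrib mult_ac)
    moreover have "Theta (P\<^sup>2 * (P * z) ^ 3) (P ^ 3) = - Theta (P\<^sup>2 * z ^ 3) (P ^ 3) / (P\<^sup>2 * z ^ 3)"
      using Theta_shift[OF P3, of "P\<^sup>2 * z ^ 3"] P that by (simp add: power_mult_distrib mult_ac)
    ultimately show ?thesis
      unfolding f_def m_def using P that
      by (simp only: Theta_shift[OF P that]) (simp add: field_simps power_numeral_reduce)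
  qed
  have g: "g (P * z) = m z * g z" if "z \<noteq> 0" for z
  proof -
    have "(P * z)\<^sup>2 = P * (P * z\<^sup>2)"
      by (simp add: power2_eq_square)
    moreover have "Theta (P * (P * z\<^sup>2)) P = - Theta (P * z\<^sup>2) P / (P * z\<^sup>2)"
      and "Theta (P * z\<^sup>2) P = - Theta (z\<^sup>2) P / z\<^sup>2"
      using Theta_shift[OF P, of "P * z\<^sup>2"] Theta_shift[OF P, of "z\<^sup>2"] P that by simp_all
    ultimately show ?thesis
      unfolding g_def m_def using P that
      by (simp only:) (simp add: field_simps power_numeral_reduce)
  qed
  have m: "m z \<noteq> 0" if "z \<noteq> 0" for z
    using P that by (simp add: m_def)
  have zeros: "f z = 0" if z: "z \<noteq> 0" "g z = 0" for z
  proof -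
    obtain n where n: "z\<^sup>2 = P powi n"
      using Theta_eq_0_iff[OF P, of "z\<^sup>2"] z by (auto simp: g_def)
    \<comment> \<open>Removing a power of \<open>P\<close> leaves a representative \<open>s\<close> with \<open>s\<^sup>2 = 1\<close> or \<open>s\<^sup>2 = P\<close>.\<close>
    define k where "k = n div 2"
    define s where "s = z / P powi k"
    have s: "s \<noteq> 0" "z = s * P powi k"
      using P z by (auto simp: s_def)
    have "s\<^sup>2 = P powi n / P powi (2 * k)"
      by (simp add: s_def power_divide n power_int_power' mult_ac)
    also have "\<dots> = P powi (n mod 2)"
      using P by (simp add: k_def power_int_diff [symmetric] minus_mult_div_eq_mod)
    finally have s2: "s\<^sup>2 = P powi (n mod 2)" .
    have "f s = 0"
    proof (cases "even n")
      case True
      hence "s\<^sup>2 = 1" using s2 by simp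
      hence "s = 1 \<or> s = -1" by (simp add: power2_eq_1_iff)
      moreover have "f (-1) = 0"
        using Theta_reflect[OF P3(2), of "- P"] P unfolding f_def
        by (simp add: power_numeral_reduce)
      moreover have "f 1 = 0"
        by (simp add: f_def Theta_one P)
      ultimately show ?thesis by blast
    next
      case False
      hence P_s: "P = s\<^sup>2"
        using s2 by (simp add: odd_iff_mod_2_eq_one)
      have "Theta (s ^ 5) (s ^ 6) = Theta s (s ^ 6)"
        using Theta_reflect[of "s ^ 6" s] s(1) by (simp add: power_numeral_reduce)
      moreover have "Theta (s ^ 7) (s ^ 6) = - Theta s (s ^ 6) / s"
      proof -
        have "P ^ 3 = s ^ 6" "s ^ 7 = s ^ 6 * s"
          by (simp_all add: P_s power_mult [symmetric] flip: power_Suc2)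
        thus ?thesis
          using Theta_shift[OF P3 s(1)] by (simp only:)
      qed
      ultimately show ?thesis
        using s(1) unfolding f_def P_s by (simp flip: power_mult power_add)
    qed
    from quasi_periodic_zero[OF P(2) f m s(1) this] show ?thesis
      using s(2) by simp
  qed
  have simple: "\<exists>d. d \<noteq> 0 \<and> (g has_field_derivative d) (at z)" if "z \<noteq> 0" "g z = 0" for z
    using Theta_monom_simple_zero[OF P, of 1 z 2] that by (simp add: g_def)
  have hol: "f holomorphic_on -{0}" "g holomorphic_on -{0}"
    unfolding f_def g_def using P P3 by (auto intro!: holomorphic_intros)
  obtain c where c: "\<And>z. z \<noteq> 0 \<Longrightarrow> f z = c * g z"
    using quasi_periodic_proportional[of P f g m] P hol f g m simple zeros by auto
  define \<omega> where "\<omega> = Complex (-1/2) (sqrt 3 / 2)"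
  have \<omega>: "\<omega>\<^sup>2 + \<omega> + 1 = 0"
    by (simp add: \<omega>_def complex_eq_iff power2_eq_square)
  have \<omega>3: "\<omega> ^ 3 = 1"
    using \<omega> by algebra
  have \<omega>0: "\<omega> \<noteq> 0" "\<omega> \<noteq> 1"
    using \<omega> by auto
  have \<omega>inv: "\<omega>\<^sup>2 = 1 / \<omega>"
    using \<omega>3 \<omega>0 by (simp add: field_simps power_numeral_reduce)
  have "Theta \<omega> P \<noteq> 0"
  proof
    assume "Theta \<omega> P = 0"
    then obtain n where n: "\<omega> = P powi n"
      using Theta_eq_0_iff[OF P \<omega>0(1)] by blast
    have "norm \<omega> = 1"
      by (simp add: \<omega>_def cmod_def power2_eq_square)
    hence "norm P powi n = 1"
      by (simp add: n norm_power_int)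
    hence "n = 0"
      by (rule norm_power_int_eq_1D[OF P])
    thus False using n \<omega>0 by simp
  qed
  moreover have "f \<omega> = Theta \<omega> P * (1 + \<omega>) * qpoch_inf P P"
  proof -
    have "P ^ 3 / P = P\<^sup>2"
      using P by (simp add: power_numeral_reduce)
    hence "Theta (P\<^sup>2) (P ^ 3) = qpoch_inf P P"
      using Theta_reflect[OF P3(2), of P] Theta_cubed_base[OF P] by simp
    thus ?thesis
      using Theta_cubed_base[OF P] by (simp add: f_def \<omega>3 algebra_simps)
  qed
  moreover have "g \<omega> = Theta \<omega> P * (1 + \<omega>)"
  proof -
    have e: "- 1 / \<omega> = 1 + \<omega>"
      using \<omega> \<omega>0 by (simp add: field_simps power2_eq_square) algebra
    have "g \<omega> = Theta \<omega> P * (- 1 / \<omega>)"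
      using Theta_inverse[OF P \<omega>0(1)] by (simp add: g_def \<omega>inv)
    thus ?thesis by (simp only: e)
  qed
  moreover have "1 + \<omega> \<noteq> 0"
    using \<omega> by auto algebra
  ultimately have "c = qpoch_inf P P"
    using c[OF \<omega>0(1)] by simp
  thus ?thesis
    using c[OF \<open>z \<noteq> 0\<close>] by (simp add: f_def g_def)
qed

text \<open>
  The quotient \<open>Theta (z\<^sup>2) P / Theta z P\<close>, written by means of the quintuple product as a sum, which
  makes sense and is holomorphic also at the zeros of the denominator.
\<close>

definition quint :: "complex \<Rightarrow> complex \<Rightarrow> complex" where
  "quint z P = (Theta (P * z ^ 3) (P ^ 3) + z * Theta (P\<^sup>2 * z ^ 3) (P ^ 3)) / qpoch_inf P P"

lemma Theta_square_eq_quint: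
  assumes "norm P < 1" "P \<noteq> 0" "z \<noteq> 0"
  shows "Theta (z\<^sup>2) P = Theta z P * quint z P"
  using quintuple_product[OF assms] qpoch_self_nonzero[OF assms(1)]
  by (simp add: quint_def field_simps)

lemma holomorphic_quint [holomorphic_intros]:
  assumes "norm P < 1" "P \<noteq> 0" "f holomorphic_on A" "\<And>z. z \<in> A \<Longrightarrow> f z \<noteq> 0"
  shows "(\<lambda>z. quint (f z) P) holomorphic_on A"
proof -
  have "norm (P ^ 3) < 1"
    using assms by (simp add: norm_power power_less_one_iff)
  thus ?thesis
    unfolding quint_def using assms qpoch_self_nonzero[OF assms(1)] by (auto intro!: holomorphic_intros)
qed

lemma quint_shift:
  assumes P: "norm P < 1" "P \<noteq> 0" and z: "z \<noteq> 0"
  shows "quint (P * z) P = - quint z P / (P * z ^ 3)"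
proof -
  have P3: "norm (P ^ 3) < 1" "P ^ 3 \<noteq> 0"
    using P by (auto simp: norm_power power_less_one_iff)
  have "Theta (P * (P * z) ^ 3) (P ^ 3) = - Theta (P * z ^ 3) (P ^ 3) / (P * z ^ 3)"
    using Theta_shift[OF P3, of "P * z ^ 3"] P z by (simp add: power_mult_distrib mult_ac)
  moreover have "Theta (P\<^sup>2 * (P * z) ^ 3) (P ^ 3) = - Theta (P\<^sup>2 * z ^ 3) (P ^ 3) / (P\<^sup>2 * z ^ 3)"
    using Theta_shift[OF P3, of "P\<^sup>2 * z ^ 3"] P z by (simp add: power_mult_distrib mult_ac)
  ultimately show ?thesis
    unfolding quint_def using P z qpoch_self_nonzero[OF P(1)]
    by (simp only:) (simp add: field_simps power_numeral_reduce)
qed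

lemma quint_inverse:
  assumes P: "P \<noteq> 0" and z: "z \<noteq> 0"
  shows "quint (1 / z) P = quint z P / z"
proof -
  have P3: "P ^ 3 \<noteq> 0"
    using P by simp
  have "P\<^sup>2 * (1 / z) ^ 3 = P ^ 3 / (P * z ^ 3)" "P * (1 / z) ^ 3 = P ^ 3 / (P\<^sup>2 * z ^ 3)"
    using P z by (simp_all add: field_simps power_numeral_reduce)
  hence "Theta (P\<^sup>2 * (1 / z) ^ 3) (P ^ 3) = Theta (P * z ^ 3) (P ^ 3)"
    and "Theta (P * (1 / z) ^ 3) (P ^ 3) = Theta (P\<^sup>2 * z ^ 3) (P ^ 3)"
    by (simp_all only: Theta_reflect[OF P3])
  thus ?thesis
    unfolding quint_def using z by (simp only:) (simp add: field_simps)
qed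

lemma quint_reflect:
  assumes "norm P < 1" "P \<noteq> 0" "z \<noteq> 0"
  shows "quint (P / z) P = - (z\<^sup>2 / P) * quint z P"
  using quint_shift[OF assms(1,2), of "1 / z"] quint_inverse[OF assms(2,3)] assms
  by (simp add: field_simps power_numeral_reduce)

lemma quint_minus_one: "P \<noteq> 0 \<Longrightarrow> quint (- 1) P = 0"
  using quint_inverse[of P "- 1"] by simp

text \<open>
  The reflection \<open>z \<mapsto> P / z\<close> fixes \<open>s\<close> and changes the sign of the value there.
\<close>

lemma quint_sqrt:
  assumes "norm P < 1" "P \<noteq> 0" "s\<^sup>2 = P"
  shows "quint s P = 0"
proof -
  have "s \<noteq> 0" "P / s = s"
    using assms by (auto simp: power2_eq_square)
  thus ?thesis
    using quint_reflect[OF assms(1,2), of s] assms by simp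
qed

section \<open>A three-term relation\<close>

text \<open>
  With respect to the nome \<open>r ^ 3\<close> the right-hand side is, up to a constant, the single theta function
  \<open>Theta (r * w) (r ^ 3)\<close>, and the left-hand side has the same factor under \<open>w \<mapsto> r ^ 3 w\<close>. Hence only
  the vanishing at \<open>w = 1 / r\<close> has to be checked; the constant comes from \<open>w = 1\<close>, where one summand
  vanishes.
\<close>

lemma Theta_three_term:
  assumes r: "norm r < 1" "r \<noteq> 0" and "w \<noteq> 0"
  shows "Theta r (r ^ 6) * (Theta (r\<^sup>2 * w) (r ^ 6) * Theta (r ^ 3 * w) (r ^ 6)
             + r * (Theta w (r ^ 6) * Theta (r ^ 5 * w) (r ^ 6)))
         = Theta (r ^ 3) (r ^ 6) * (Theta (r * w) (r ^ 6) * Theta (r ^ 4 * w) (r ^ 6))"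
proof -
  define f where "f = (\<lambda>w. Theta (r\<^sup>2 * w) (r ^ 6) * Theta (r ^ 3 * w) (r ^ 6)
      + r * (Theta w (r ^ 6) * Theta (r ^ 5 * w) (r ^ 6)))"
  define g where "g = (\<lambda>w. Theta (r * w) (r ^ 3))"
  define m where "m = (\<lambda>w. - 1 / (r * w))"
  have r3: "norm (r ^ 3) < 1" "r ^ 3 \<noteq> 0" and r6: "norm (r ^ 6) < 1" "r ^ 6 \<noteq> 0"
    using r by (auto simp: norm_power power_less_one_iff)
  have f: "f (r ^ 3 * w) = m w * f w" if "w \<noteq> 0" for w
  proof -
    have "Theta (r ^ 6 * w) (r ^ 6) = - Theta w (r ^ 6) / w"
      using Theta_shift[OF r6 that] .
    moreover have "Theta (r ^ 8 * w) (r ^ 6) = - Theta (r\<^sup>2 * w) (r ^ 6) / (r\<^sup>2 * w)"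
      using Theta_shift_power[OF r that, of 6 2] by simp
    ultimately show ?thesis
      using r that unfolding f_def m_def
      by (simp add: mult.assoc [symmetric] flip: power_add) (simp add: field_simps power_numeral_reduce)
  qed
  have g: "g (r ^ 3 * w) = m w * g w" if "w \<noteq> 0" for w
    using Theta_shift[OF r3, of "r * w"] r that unfolding g_def m_def by (simp add: mult_ac)
  have m: "m w \<noteq> 0" if "w \<noteq> 0" for w
    using r that by (simp add: m_def)
  have zeros: "f w = 0" if w: "w \<noteq> 0" "g w = 0" for w
  proof -
    obtain n where n: "r * w = (r ^ 3) powi n"
      using Theta_eq_0_iff[OF r3, of "r * w"] w r by (auto simp: g_def)
    have "Theta (1 / r) (r ^ 6) = - Theta r (r ^ 6) / r"
      by (rule Theta_inverse[OF r6 r(2)])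
    moreover have "Theta (r ^ 4) (r ^ 6) = Theta (r\<^sup>2) (r ^ 6)"
      using Theta_reflect_power[OF r(2), of 2 6 1] by simp
    ultimately have "f (1 / r) = 0"
      using r unfolding f_def by (simp add: power_numeral_reduce)
    from quasi_periodic_zero[OF r3(2) f m _ this, of n] r
    have "f ((r ^ 3) powi n / r) = 0" by simp
    moreover have "w = (r ^ 3) powi n / r"
      using n r by (simp add: field_simps)
    ultimately show ?thesis by simp
  qed
  have simple: "\<exists>d. d \<noteq> 0 \<and> (g has_field_derivative d) (at w)" if "w \<noteq> 0" "g w = 0" for w
    using Theta_monom_simple_zero[OF r3 r(2), of w 1] that by (simp add: g_def)
  have hol: "f holomorphic_on -{0}" "g holomorphic_on -{0}"
    unfolding f_def g_def using r r3 r6 by (auto intro!: holomorphic_intros)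
  obtain c where c: "\<And>w. w \<noteq> 0 \<Longrightarrow> f w = c * g w"
    using quasi_periodic_proportional[of "r ^ 3" f g m] r3 hol f g m simple zeros by auto
  \<comment> \<open>The ratio between the theta function with nome \<open>r ^ 3\<close> and the product of two with nome \<open>r ^ 6\<close>.\<close>
  define E where "E = qpoch_inf (r ^ 3) (r ^ 3) / (qpoch_inf (r ^ 6) (r ^ 6))\<^sup>2"
  have g': "g w = E * (Theta (r * w) (r ^ 6) * Theta (r ^ 4 * w) (r ^ 6))" if "w \<noteq> 0" for w
  proof -
    have e: "r ^ 3 * (r * w) = r ^ 4 * w" "(r ^ 3)\<^sup>2 = r ^ 6"
      by (simp_all add: power_numeral_reduce)
    show ?thesis
      using Theta_dissect[OF r3, of "r * w", unfolded e] r that qpoch_self_nonzero[OF r6(1)]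
      by (simp add: g_def E_def field_simps)
  qed
  have "f 1 = Theta (r\<^sup>2) (r ^ 6) * Theta (r ^ 3) (r ^ 6)"
    by (simp add: f_def Theta_one r6)
  moreover have "Theta (r ^ 4) (r ^ 6) = Theta (r\<^sup>2) (r ^ 6)"
    using Theta_reflect_power[OF r(2), of 2 6 1] by simp
  moreover have "f 1 = c * (E * (Theta r (r ^ 6) * Theta (r ^ 4) (r ^ 6)))"
    using c[of 1] g'[of 1] by simp
  ultimately have "Theta (r\<^sup>2) (r ^ 6) * Theta (r ^ 3) (r ^ 6) = Theta (r\<^sup>2) (r ^ 6) * (c * E * Theta r (r ^ 6))"
    by (simp only: mult_ac)
  moreover have "Theta (r\<^sup>2) (r ^ 6) \<noteq> 0"
    using Theta_cubed_base[of "r\<^sup>2"] qpoch_self_nonzero[of "r\<^sup>2"] r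
    by (simp add: norm_power power_less_one_iff flip: power_mult)
  ultimately have r3: "Theta (r ^ 3) (r ^ 6) = c * E * Theta r (r ^ 6)"
    by simp
  have "f w = c * (E * (Theta (r * w) (r ^ 6) * Theta (r ^ 4 * w) (r ^ 6)))"
    using c[OF assms(3)] g'[OF assms(3)] by simp
  thus ?thesis
    unfolding f_def r3 by (simp only: mult_ac)
qed

section \<open>Eta quotients\<close>

text \<open>
  The quotient \<open>(q\<^sup>2; q\<^sup>2)\<^sup>2 / (q; q)\<close> is Ramanujan's function \<open>\<psi>(q)\<close>. It enters the constants below, and is
  called \<open>\<psi>\<close> in the proofs.
\<close>

lemma Theta_minus_one:
  assumes "norm q < 1"
  shows "Theta (- 1) q = 2 * ((qpoch_inf (q\<^sup>2) (q\<^sup>2))\<^sup>2 / qpoch_inf q q)"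
  using qpoch_head[OF assms, of "- 1"] qpoch_square[OF assms, of q] qpoch_self_nonzero[OF assms]
  by (simp add: Theta_def power2_eq_square)

lemma Theta_minus_base4:
  assumes "norm q < 1" "q \<noteq> 0"
  shows "Theta (- q) (q ^ 4) = (qpoch_inf (q\<^sup>2) (q\<^sup>2))\<^sup>2 / qpoch_inf q q"
proof -
  have q2: "norm (q\<^sup>2) < 1"
    using assms by (simp add: norm_power power_less_one_iff)
  have "qpoch_inf (- q) (q\<^sup>2) = qpoch_inf (- q) (q ^ 4) * qpoch_inf (- (q ^ 3)) (q ^ 4)"
  proof -
    have "(q\<^sup>2)\<^sup>2 = q ^ 4" "q\<^sup>2 * - q = - (q ^ 3)"
      by (simp_all add: power_numeral_reduce)
    thus ?thesis
      using qpoch_dissect2[OF q2, of "- q"] by (simp only:)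
  qed
  moreover have "qpoch_inf (- q) q = qpoch_inf (- q) (q\<^sup>2) * qpoch_inf (- (q\<^sup>2)) (q\<^sup>2)"
    using qpoch_dissect2[OF assms(1), of "- q"] by (simp add: power2_eq_square)
  moreover have "qpoch_inf (q\<^sup>2) (q\<^sup>2) = qpoch_inf q q * qpoch_inf (- q) q"
    by (rule qpoch_square[OF assms(1)])
  moreover have "qpoch_inf (q ^ 4) (q ^ 4) = qpoch_inf (q\<^sup>2) (q\<^sup>2) * qpoch_inf (- (q\<^sup>2)) (q\<^sup>2)"
    using qpoch_square[OF q2, of "q\<^sup>2"] by (simp flip: power_mult)
  moreover have "q ^ 4 / - q = - (q ^ 3)"
    using assms by (simp add: power_numeral_reduce)
  ultimately show ?thesis
    using qpoch_self_nonzero[OF assms(1)] unfolding Theta_def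
    by (simp add: field_simps power2_eq_square)
qed

lemma Theta_base_square:
  assumes "norm Q < 1" "Q \<noteq> 0"
  shows "Theta Q (Q\<^sup>2) = (qpoch_inf Q Q)\<^sup>2 / qpoch_inf (Q\<^sup>2) (Q\<^sup>2)"
proof -
  have "norm (Q\<^sup>2) < 1"
    using assms by (simp add: norm_power power_less_one_iff)
  moreover have "qpoch_inf Q Q = qpoch_inf Q (Q\<^sup>2) * qpoch_inf (Q\<^sup>2) (Q\<^sup>2)"
    using qpoch_dissect2[OF assms(1), of Q] by (simp add: power2_eq_square)
  ultimately show ?thesis
    using assms qpoch_self_nonzero[of "Q\<^sup>2"]
    by (simp add: Theta_def power2_eq_square)
qed

text \<open>
  By the quintuple product the value is \<open>Theta (q\<^sup>2) (q ^ 6) / Theta q (q ^ 6)\<close>; all factors involved are among the six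
  products \<open>(q ^ j; q ^ 6)\<close> with \<open>1 \<le> j \<le> 6\<close>, in which the equation becomes an identity of monomials.
\<close>

lemma quint_base6:
  assumes "norm q < 1" "q \<noteq> 0"
  shows "qpoch_inf (q ^ 6) (q ^ 6) * quint q (q ^ 6)
           = qpoch_inf (q ^ 3) (q ^ 3) / qpoch_inf (q ^ 6) (q ^ 6)
             * ((qpoch_inf (q\<^sup>2) (q\<^sup>2))\<^sup>2 / qpoch_inf q q)"
proof -
  have less: "norm (q ^ n) < 1" if "0 < n" for n
    using that assms by (simp add: norm_power power_less_one_iff)
  define a where "a = (\<lambda>j. qpoch_inf (q ^ j) (q ^ 6))"
  have e: "(q\<^sup>2) ^ 3 = q ^ 6" "(q ^ 3)\<^sup>2 = q ^ 6" "q\<^sup>2 * q = q ^ 3" "(q\<^sup>2)\<^sup>2 * q = q ^ 5"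
    "q\<^sup>2 * q\<^sup>2 = q ^ 4" "(q\<^sup>2)\<^sup>2 * q\<^sup>2 = q ^ 6" "q ^ 3 * q ^ 3 = q ^ 6"
    by (simp_all add: power_numeral_reduce)
  have 2: "qpoch_inf (q\<^sup>2) (q\<^sup>2) = a 2 * a 4 * a 6"
    using qpoch_dissect3[OF less[of 2], of "q\<^sup>2"] unfolding e by (simp add: a_def)
  have "qpoch_inf q (q\<^sup>2) = a 1 * a 3 * a 5"
    using qpoch_dissect3[OF less[of 2], of q] unfolding e by (simp add: a_def)
  hence 1: "qpoch_inf q q = a 1 * a 2 * a 3 * a 4 * a 5 * a 6"
    using qpoch_dissect2[OF assms(1), of q] 2 by (simp add: power2_eq_square mult_ac)
  have 3: "qpoch_inf (q ^ 3) (q ^ 3) = a 3 * a 6"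
    using qpoch_dissect2[OF less[of 3], of "q ^ 3"] unfolding e by (simp add: a_def)
  have nz: "a 1 \<noteq> 0" "a 2 \<noteq> 0" "a 3 \<noteq> 0" "a 4 \<noteq> 0" "a 5 \<noteq> 0" "a 6 \<noteq> 0"
    using 1 qpoch_self_nonzero[OF assms(1)] by auto
  have "q ^ 6 / q = q ^ 5" "q ^ 6 / q\<^sup>2 = q ^ 4"
    using assms by (simp_all add: power_numeral_reduce)
  hence T: "Theta q (q ^ 6) = a 1 * a 5 * a 6" "Theta (q\<^sup>2) (q ^ 6) = a 2 * a 4 * a 6"
    by (simp_all add: Theta_def a_def)
  have "Theta (q\<^sup>2) (q ^ 6) = Theta q (q ^ 6) * quint q (q ^ 6)"
    using assms by (intro Theta_square_eq_quint less) auto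
  hence "quint q (q ^ 6) = a 2 * a 4 * a 6 / (a 1 * a 5 * a 6)"
    unfolding T using nz by (simp add: field_simps)
  moreover have "qpoch_inf (q ^ 6) (q ^ 6) = a 6"
    by (simp add: a_def)
  ultimately show ?thesis
    unfolding 1 2 3 using nz by (simp add: field_simps power2_eq_square)
qed

lemma psi_nonzero:
  assumes "norm q < 1"
  shows "(qpoch_inf (q\<^sup>2) (q\<^sup>2))\<^sup>2 / qpoch_inf q q \<noteq> 0"
  using qpoch_self_nonzero[OF assms] qpoch_self_nonzero[of "q\<^sup>2"] assms
  by (simp add: norm_power power_less_one_iff)

section \<open>The quintuple quotient with nome the sixth power\<close>

lemma quint_shift6:
  assumes "norm q < 1" "q \<noteq> 0" "z \<noteq> 0"
  shows "quint (q ^ (a + 6) * z) (q ^ 6) = - quint (q ^ a * z) (q ^ 6) / (q ^ (3 * a + 6) * z ^ 3)"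
  using quint_shift[of "q ^ 6" "q ^ a * z"] assms
  by (simp add: norm_power power_less_one_iff power_add power_mult_distrib mult_ac flip: power_mult)

lemma quint_expand6:
  assumes "norm q < 1" "q \<noteq> 0"
  shows "quint z (q ^ 6) * qpoch_inf (q ^ 6) (q ^ 6)
     = Theta (q ^ 6 * z ^ 3) (q ^ 18) + z * Theta (q ^ 12 * z ^ 3) (q ^ 18)"
  using qpoch_self_nonzero[of "q ^ 6"] assms
  by (simp add: quint_def norm_power power_less_one_iff flip: power_mult)

text \<open>
  Instances of the shift and reflection relations. They make the summands of the left-hand sides cancel
  at the zeros \<open>-1\<close> and \<open>-q\<close> of the right-hand sides, and evaluate the left-hand sides where the constants
  are determined.
\<close>

lemma quint_values6:
  assumes "norm q < 1" "q \<noteq> 0"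
  shows "quint (q ^ 3) (q ^ 6) = 0" "quint (- (q ^ 3)) (q ^ 6) = 0"
    "quint (q ^ 5) (q ^ 6) = - quint q (q ^ 6) / q ^ 4"
    "quint (- (q ^ 5)) (q ^ 6) = - quint (- q) (q ^ 6) / q ^ 4"
    "quint (- (q ^ 4)) (q ^ 6) = - quint (- (q\<^sup>2)) (q ^ 6) / q\<^sup>2"
    "quint (- (q ^ 6)) (q ^ 6) = 0"
    "quint (q ^ 7) (q ^ 6) = - quint q (q ^ 6) / q ^ 9"
proof -
  have Q: "norm (q ^ 6) < 1" "q ^ 6 \<noteq> 0"
    using assms by (auto simp: norm_power power_less_one_iff)
  show "quint (q ^ 3) (q ^ 6) = 0" "quint (- (q ^ 3)) (q ^ 6) = 0"
    by (rule quint_sqrt[OF Q]; simp flip: power_mult)+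
  have e: "q ^ 6 / q = q ^ 5" "q ^ 6 / - q = - (q ^ 5)" "q ^ 6 / - (q\<^sup>2) = - (q ^ 4)"
    using assms by (simp_all add: power_numeral_reduce)
  show "quint (q ^ 5) (q ^ 6) = - quint q (q ^ 6) / q ^ 4"
    using quint_reflect[OF Q, of q] assms unfolding e by (simp add: power_numeral_reduce)
  show "quint (- (q ^ 5)) (q ^ 6) = - quint (- q) (q ^ 6) / q ^ 4"
    using quint_reflect[OF Q, of "- q"] assms unfolding e by (simp add: power_numeral_reduce)
  show "quint (- (q ^ 4)) (q ^ 6) = - quint (- (q\<^sup>2)) (q ^ 6) / q\<^sup>2"
    using quint_reflect[OF Q, of "- (q\<^sup>2)"] assms unfolding e by (simp add: power_numeral_reduce)
  show "quint (- (q ^ 6)) (q ^ 6) = 0"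
    using quint_shift[OF Q, of "- 1"] quint_minus_one[OF Q(2)] by simp
  show "quint (q ^ 7) (q ^ 6) = - quint q (q ^ 6) / q ^ 9"
    using quint_shift6[OF assms, of 1 1] by simp
qed

lemma Theta_values18:
  assumes "norm q < 1" "q \<noteq> 0"
  shows "Theta (q ^ 12) (q ^ 18) = qpoch_inf (q ^ 6) (q ^ 6)"
    "Theta (q ^ 6) (q ^ 18) = qpoch_inf (q ^ 6) (q ^ 6)"
    "Theta (q ^ 15) (q ^ 18) = Theta (q ^ 3) (q ^ 18)"
    "Theta (- (q ^ 12)) (q ^ 18) = Theta (- (q ^ 6)) (q ^ 18)"
    "Theta (- (q ^ 15)) (q ^ 18) = Theta (- (q ^ 3)) (q ^ 18)"
    "Theta (q ^ 21) (q ^ 18) = - Theta (q ^ 3) (q ^ 18) / q ^ 3"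
    "Theta (q ^ 27) (q ^ 18) = - Theta (q ^ 9) (q ^ 18) / q ^ 9"
proof -
  have Q: "norm (q ^ 6) < 1" "q ^ 6 \<noteq> 0"
    using assms by (auto simp: norm_power power_less_one_iff)
  show 6: "Theta (q ^ 6) (q ^ 18) = qpoch_inf (q ^ 6) (q ^ 6)"
    using Theta_cubed_base[OF Q] by (simp flip: power_mult)
  show "Theta (q ^ 12) (q ^ 18) = qpoch_inf (q ^ 6) (q ^ 6)"
    using Theta_reflect_power[OF assms(2), of 6 18 1] 6 by simp
  show "Theta (q ^ 15) (q ^ 18) = Theta (q ^ 3) (q ^ 18)"
    using Theta_reflect_power[OF assms(2), of 3 18 1] by simp
  show "Theta (- (q ^ 12)) (q ^ 18) = Theta (- (q ^ 6)) (q ^ 18)"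
    using Theta_reflect_power[OF assms(2), of 6 18 "- 1"] by simp
  show "Theta (- (q ^ 15)) (q ^ 18) = Theta (- (q ^ 3)) (q ^ 18)"
    using Theta_reflect_power[OF assms(2), of 3 18 "- 1"] by simp
  show "Theta (q ^ 21) (q ^ 18) = - Theta (q ^ 3) (q ^ 18) / q ^ 3"
    using Theta_shift_power[OF assms, of 1 18 3] by simp
  show "Theta (q ^ 27) (q ^ 18) = - Theta (q ^ 9) (q ^ 18) / q ^ 9"
    using Theta_shift_power[OF assms, of 1 18 9] by simp
qed

lemma Theta_sum_eq_quint:
  assumes "norm q < 1" "q \<noteq> 0"
  shows "Theta (q ^ 9) (q ^ 18) + q * Theta (q ^ 3) (q ^ 18) = quint q (q ^ 6) * qpoch_inf (q ^ 6) (q ^ 6)"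
  using quint_expand6[OF assms, of q] Theta_values18[OF assms] by (simp flip: power_add)

text \<open>
  In the last three cases the numerator is first shifted by \<open>q ^ 6\<close>, which produces the monomial. The
  factor \<open>t\<close> lets the equations be used for rewriting a product divided by a theta function.
\<close>

lemma Theta_square_quotient_eq_quint:
  assumes "norm q < 1" "q \<noteq> 0" "z \<noteq> 0"
  shows "Theta z (q ^ 6) \<noteq> 0 \<Longrightarrow> Theta (z\<^sup>2) (q ^ 6) * t / Theta z (q ^ 6) = quint z (q ^ 6) * t"
    "Theta (q * z) (q ^ 6) \<noteq> 0 \<Longrightarrow>
       Theta (q\<^sup>2 * z\<^sup>2) (q ^ 6) * t / Theta (q * z) (q ^ 6) = quint (q * z) (q ^ 6) * t"
    "Theta (q\<^sup>2 * z) (q ^ 6) \<noteq> 0 \<Longrightarrow>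
       Theta (q ^ 4 * z\<^sup>2) (q ^ 6) * t / Theta (q\<^sup>2 * z) (q ^ 6) = quint (q\<^sup>2 * z) (q ^ 6) * t"
    "Theta (q ^ 3 * z) (q ^ 6) \<noteq> 0 \<Longrightarrow>
       Theta (z\<^sup>2) (q ^ 6) * t / Theta (q ^ 3 * z) (q ^ 6) = - (z\<^sup>2) * quint (q ^ 3 * z) (q ^ 6) * t"
    "Theta (q ^ 4 * z) (q ^ 6) \<noteq> 0 \<Longrightarrow>
       Theta (q\<^sup>2 * z\<^sup>2) (q ^ 6) * t / Theta (q ^ 4 * z) (q ^ 6) = - (q\<^sup>2 * z\<^sup>2) * quint (q ^ 4 * z) (q ^ 6) * t"
    "Theta (q ^ 5 * z) (q ^ 6) \<noteq> 0 \<Longrightarrow>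
       Theta (q ^ 4 * z\<^sup>2) (q ^ 6) * t / Theta (q ^ 5 * z) (q ^ 6) = - (q ^ 4 * z\<^sup>2) * quint (q ^ 5 * z) (q ^ 6) * t"
proof -
  have Q: "norm (q ^ 6) < 1" "q ^ 6 \<noteq> 0"
    using assms by (auto simp: norm_power power_less_one_iff)
  have sq: "Theta (q ^ (2 * k) * z\<^sup>2) (q ^ 6) = Theta (q ^ k * z) (q ^ 6) * quint (q ^ k * z) (q ^ 6)" for k
    using Theta_square_eq_quint[OF Q, of "q ^ k * z"] assms
    by (simp add: power_mult_distrib mult.commute flip: power_mult)
  have sh: "Theta (q ^ (a + 6) * z\<^sup>2) (q ^ 6) = - Theta (q ^ a * z\<^sup>2) (q ^ 6) / (q ^ a * z\<^sup>2)" for a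
    using Theta_shift_power[OF assms(1,2), of "z\<^sup>2" 6 a] assms by simp
  show "Theta z (q ^ 6) \<noteq> 0 \<Longrightarrow> Theta (z\<^sup>2) (q ^ 6) * t / Theta z (q ^ 6) = quint z (q ^ 6) * t"
    using sq[of 0] by simp
  show "Theta (q * z) (q ^ 6) \<noteq> 0 \<Longrightarrow>
       Theta (q\<^sup>2 * z\<^sup>2) (q ^ 6) * t / Theta (q * z) (q ^ 6) = quint (q * z) (q ^ 6) * t"
    using sq[of 1] by simp
  show "Theta (q\<^sup>2 * z) (q ^ 6) \<noteq> 0 \<Longrightarrow>
       Theta (q ^ 4 * z\<^sup>2) (q ^ 6) * t / Theta (q\<^sup>2 * z) (q ^ 6) = quint (q\<^sup>2 * z) (q ^ 6) * t"
    using sq[of 2] by simp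
  show "Theta (q ^ 3 * z) (q ^ 6) \<noteq> 0 \<Longrightarrow>
       Theta (z\<^sup>2) (q ^ 6) * t / Theta (q ^ 3 * z) (q ^ 6) = - (z\<^sup>2) * quint (q ^ 3 * z) (q ^ 6) * t"
    using sq[of 3] sh[of 0] assms by (simp add: field_simps)
  show "Theta (q ^ 4 * z) (q ^ 6) \<noteq> 0 \<Longrightarrow>
       Theta (q\<^sup>2 * z\<^sup>2) (q ^ 6) * t / Theta (q ^ 4 * z) (q ^ 6) = - (q\<^sup>2 * z\<^sup>2) * quint (q ^ 4 * z) (q ^ 6) * t"
    using sq[of 4] sh[of 2] assms by (simp add: field_simps)
  show "Theta (q ^ 5 * z) (q ^ 6) \<noteq> 0 \<Longrightarrow>
       Theta (q ^ 4 * z\<^sup>2) (q ^ 6) * t / Theta (q ^ 5 * z) (q ^ 6) = - (q ^ 4 * z\<^sup>2) * quint (q ^ 5 * z) (q ^ 6) * t"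
    using sq[of 5] sh[of 4] assms by (simp add: field_simps)
qed

text \<open>
  At a cube root of unity the expansion involves only two theta constants, so that the vanishing of a
  combination of these values becomes polynomial algebra.
\<close>

lemma quint_cube_root:
  assumes q: "norm q < 1" "q \<noteq> 0" and \<zeta>: "\<zeta> ^ 3 = 1"
  defines "E \<equiv> qpoch_inf (q ^ 6) (q ^ 6)"
    and "T3 \<equiv> Theta (q ^ 3) (q ^ 18)" and "T9 \<equiv> Theta (q ^ 9) (q ^ 18)"
  shows "quint (q * \<zeta>) (q ^ 6) = (T9 + q * \<zeta> * T3) / E"
    "quint (q ^ 3 * \<zeta>) (q ^ 6) = (1 - \<zeta>) * T3 / E"
    "quint (q ^ 5 * \<zeta>) (q ^ 6) = - (q * T3 + \<zeta> * T9) / (q ^ 4 * E)"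
proof -
  have E: "E \<noteq> 0"
    using qpoch_self_nonzero[of "q ^ 6"] q by (simp add: E_def norm_power power_less_one_iff)
  have ex: "quint (q ^ k * \<zeta>) (q ^ 6) * E
      = Theta (q ^ (3 * k + 6)) (q ^ 18) + q ^ k * \<zeta> * Theta (q ^ (3 * k + 12)) (q ^ 18)" for k
    using quint_expand6[OF q, of "q ^ k * \<zeta>"] \<zeta>
    by (simp add: E_def power_mult_distrib mult_ac power_add flip: power_mult)
  have "quint (q * \<zeta>) (q ^ 6) * E = T9 + q * \<zeta> * T3"
    using ex[of 1] by (simp add: T3_def T9_def Theta_values18[OF q])
  thus "quint (q * \<zeta>) (q ^ 6) = (T9 + q * \<zeta> * T3) / E"
    using E by (simp add: field_simps)
  have "quint (q ^ 3 * \<zeta>) (q ^ 6) * E = (1 - \<zeta>) * T3"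
    using ex[of 3] q by (simp add: T3_def Theta_values18[OF q] field_simps)
  thus "quint (q ^ 3 * \<zeta>) (q ^ 6) = (1 - \<zeta>) * T3 / E"
    using E by (simp add: field_simps)
  have "quint (q ^ 5 * \<zeta>) (q ^ 6) * E = - T3 / q ^ 3 + q ^ 5 * \<zeta> * (- T9 / q ^ 9)"
    using ex[of 5] by (simp add: T3_def T9_def Theta_values18[OF q])
  also have "\<dots> = - (q * T3 + \<zeta> * T9) / q ^ 4"
    using q by (simp add: field_simps power_numeral_reduce)
  finally have "quint (q ^ 5 * \<zeta>) (q ^ 6) = - (q * T3 + \<zeta> * T9) / q ^ 4 / E"
    using nonzero_eq_divide_eq[OF E] by blast
  thus "quint (q ^ 5 * \<zeta>) (q ^ 6) = - (q * T3 + \<zeta> * T9) / (q ^ 4 * E)"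
    by (simp only: divide_divide_eq_left)
qed

section \<open>Zeros of the right-hand sides\<close>

lemma Theta_minus_eq_0_cases:
  assumes "norm q < 1" "q \<noteq> 0" "z \<noteq> 0" "Theta (- z) q = 0"
  obtains k where "z = - 1 * (q\<^sup>2) powi k" | k where "z = - q * (q\<^sup>2) powi k"
proof -
  obtain n where n: "- z = q powi n"
    using Theta_eq_0_iff[OF assms(1,2), of "- z"] assms by auto
  define k where "k = n div 2"
  have *: "(q\<^sup>2) powi k = q powi (2 * k)"
    by (simp add: power_int_mult)
  show ?thesis
  proof (cases "even n")
    case True
    hence "n = 2 * k" by (simp add: k_def)
    hence "z = - 1 * (q\<^sup>2) powi k" using n * by (simp add: minus_equation_iff[of z])
    thus ?thesis by (rule that)
  next
    case False
    hence "n = 2 * k + 1" by (simp add: k_def)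
    hence "- z = q powi (2 * k) * q" using n assms by (simp add: power_int_add)
    hence "z = - q * (q\<^sup>2) powi k" by (simp add: * minus_equation_iff[of z] mult.commute)
    thus ?thesis by (rule that)
  qed
qed

lemma Theta_cube_eq_0_cases:
  assumes "norm q < 1" "q \<noteq> 0" "z \<noteq> 0" "Theta (z ^ 3) (q ^ 6) = 0"
  obtains \<zeta> k where "\<zeta> ^ 3 = 1" "z = \<zeta> * (q\<^sup>2) powi k"
proof -
  have "norm (q ^ 6) < 1" "q ^ 6 \<noteq> 0" "z ^ 3 \<noteq> 0"
    using assms by (auto simp: norm_power power_less_one_iff)
  then obtain n where n: "z ^ 3 = (q ^ 6) powi n"
    using Theta_eq_0_iff assms(4) by blast
  define u where "u = (q\<^sup>2) powi n"
  have "u \<noteq> 0"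
    using assms by (simp add: u_def)
  moreover have "u ^ 3 = (q ^ 6) powi n"
  proof -
    have "u ^ 3 = q powi (2 * n * 3)"
      unfolding u_def by (simp only: power_int_mult power_int_numeral)
    also have "2 * n * 3 = 6 * n"
      by simp
    also have "q powi (6 * n) = (q ^ 6) powi n"
      by (simp only: power_int_mult power_int_numeral)
    finally show ?thesis .
  qed
  ultimately show ?thesis
    using that[of "z / u" n] n by (simp add: u_def power_divide)
qed

text \<open>
  A common zero \<open>z\<close> would satisfy both \<open>z ^ 3 = q powi a\<close> and \<open>z ^ 3 = - (q powi b)\<close>. Comparing norms gives
  \<open>a = b\<close>, which is absurd. Hence the zeros of the product of the two theta functions stay simple.
\<close>

lemma Theta_zeros_disjoint:
  assumes q: "norm q < 1" "q \<noteq> 0" and z: "z \<noteq> 0" and "Theta (- z) q = 0"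
  shows "Theta (z ^ 3) (q ^ 6) \<noteq> 0"
proof
  assume *: "Theta (z ^ 3) (q ^ 6) = 0"
  have "norm (q ^ 6) < 1" "q ^ 6 \<noteq> 0" "z ^ 3 \<noteq> 0"
    using q z by (auto simp: norm_power power_less_one_iff)
  then obtain n where "z ^ 3 = (q ^ 6) powi n"
    using Theta_eq_0_iff * by blast
  hence n: "z ^ 3 = q powi (6 * n)"
    by (simp add: power_int_mult)
  obtain m where "- z = q powi m"
    using Theta_eq_0_iff[OF q, of "- z"] assms by auto
  hence "(- z) ^ 3 = q powi (m * 3)"
    by (simp add: power_int_mult)
  hence m: "z ^ 3 = - (q powi (3 * m))"
    by (simp add: mult.commute minus_equation_iff[of "z ^ 3"])
  have "norm q powi (6 * n) = norm q powi (3 * m)"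
    using n m by (metis norm_minus_cancel norm_power_int)
  hence "norm q powi (6 * n - 3 * m) = 1"
    using q by (simp add: power_int_diff)
  hence "6 * n - 3 * m = 0"
    by (rule norm_power_int_eq_1D[OF q])
  hence "6 * n = 3 * m"
    by simp
  hence "q powi (6 * n) = q powi (3 * m)"
    by (simp only:)
  hence "z ^ 3 = - (z ^ 3)"
    using n m by (simp only:)
  thus False
    using z by simp
qed

section \<open>The five identities in terms of the quintuple quotient\<close>

text \<open>
  In the quintuple expansions the terms with \<open>Theta (q ^ 9 * z ^ 3) (q ^ 18)\<close> cancel on the left, and the other
  two agree with those on the right.
\<close>

lemma quint_three_term:
  assumes "norm q < 1" "q \<noteq> 0" "z \<noteq> 0"
  shows "quint (q * z) (q ^ 6) + q ^ 4 * z\<^sup>2 * quint (q ^ 5 * z) (q ^ 6) = q * z * quint (q ^ 3 * z) (q ^ 6)"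
proof -
  define E where "E = qpoch_inf (q ^ 6) (q ^ 6)"
  define T where "T = (\<lambda>j. Theta (q ^ j * z ^ 3) (q ^ 18))"
  have E: "E \<noteq> 0"
    using qpoch_self_nonzero[of "q ^ 6"] assms by (simp add: E_def norm_power power_less_one_iff)
  have ex: "quint (q ^ k * z) (q ^ 6) * E = T (3 * k + 6) + q ^ k * z * T (3 * k + 12)" for k
    using quint_expand6[OF assms(1,2), of "q ^ k * z"]
    by (simp add: E_def T_def power_mult_distrib mult_ac power_add flip: power_mult)
  have "T 27 = - T 9 / (q ^ 9 * z ^ 3)"
    using Theta_shift_power[OF assms(1,2), of "z ^ 3" 18 9] assms by (simp add: T_def)
  hence "(quint (q * z) (q ^ 6) + q ^ 4 * z\<^sup>2 * quint (q ^ 5 * z) (q ^ 6)) * E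
      = q * z * (quint (q ^ 3 * z) (q ^ 6) * E)"
    using ex[of 1] ex[of 3] ex[of 5] assms
    by (simp add: ring_distribs mult.assoc) (simp add: field_simps power_numeral_reduce)
  thus ?thesis
    using E by (simp add: mult.assoc [symmetric])
qed

text \<open>
  Under \<open>x \<mapsto> q\<^sup>2 x\<close> the three summands are permuted cyclically, up to the factor by which the right-hand
  side is multiplied. The right-hand side has the zeros \<open>-1\<close> and \<open>-q\<close> modulo powers of \<open>q\<^sup>2\<close>. At \<open>x = 1\<close> the middle
  summand vanishes and the other two coincide, which gives the constant.
\<close>

lemma quint_sum_eq_Theta:
  assumes q: "norm q < 1" "q \<noteq> 0" and "x \<noteq> 0"
  shows "- (q ^ 4 * x\<^sup>2) * quint (q ^ 5 * x) (q ^ 6) * Theta (q ^ 6 * x ^ 3) (q ^ 18)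
      - q ^ 3 * quint (q ^ 3 * x) (q ^ 6) * Theta (x ^ 3) (q ^ 18)
      + x * quint (q * x) (q ^ 6) * Theta (q ^ 12 * x ^ 3) (q ^ 18)
    = qpoch_inf (q ^ 3) (q ^ 3) * Theta (- x) q / qpoch_inf (q ^ 6) (q ^ 6)"
proof -
  define f where "f = (\<lambda>x. - (q ^ 4 * x\<^sup>2) * quint (q ^ 5 * x) (q ^ 6) * Theta (q ^ 6 * x ^ 3) (q ^ 18)
      - q ^ 3 * quint (q ^ 3 * x) (q ^ 6) * Theta (x ^ 3) (q ^ 18)
      + x * quint (q * x) (q ^ 6) * Theta (q ^ 12 * x ^ 3) (q ^ 18))"
  define g where "g = (\<lambda>x. Theta (- x) q)"
  define m where "m = (\<lambda>x. 1 / (q * x\<^sup>2))"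
  have less: "norm (q ^ n) < 1" if "0 < n" for n
    using that q by (simp add: norm_power power_less_one_iff)
  have f: "f (q\<^sup>2 * x) = m x * f x" if x: "x \<noteq> 0" for x
  proof -
    have e: "(q\<^sup>2 * x) ^ 3 = q ^ 6 * x ^ 3" "(q\<^sup>2 * x)\<^sup>2 = q ^ 4 * x\<^sup>2"
      "q ^ 5 * (q\<^sup>2 * x) = q ^ 7 * x" "q ^ 3 * (q\<^sup>2 * x) = q ^ 5 * x" "q * (q\<^sup>2 * x) = q ^ 3 * x"
      "q ^ 6 * (q ^ 6 * x ^ 3) = q ^ 12 * x ^ 3" "q ^ 12 * (q ^ 6 * x ^ 3) = q ^ 18 * x ^ 3"
      by (simp_all add: power_mult_distrib power_numeral_reduce)
    have "quint (q ^ 7 * x) (q ^ 6) = - quint (q * x) (q ^ 6) / (q ^ 9 * x ^ 3)"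
      using quint_shift6[OF q x, of 1] by simp
    moreover have "Theta (q ^ 18 * x ^ 3) (q ^ 18) = - Theta (x ^ 3) (q ^ 18) / x ^ 3"
      using Theta_shift_power[OF q, of "x ^ 3" 18 0] x by simp
    ultimately show ?thesis
      unfolding f_def m_def e using q x by (simp only:) (simp add: field_simps power_numeral_reduce)
  qed
  have g: "g (q\<^sup>2 * x) = m x * g x" if x: "x \<noteq> 0" for x
    using Theta_shift[OF q, of "- (q * x)"] Theta_shift[OF q, of "- x"] q x
    by (simp add: g_def m_def power2_eq_square mult.assoc)
  have m: "m x \<noteq> 0" if "x \<noteq> 0" for x
    using q that by (simp add: m_def)
  have "f (- 1) = 0"
    using q by (simp add: f_def quint_values6 Theta_values18)
  moreover have "f (- q) = 0"
  proof -
    have e: "q ^ 5 * - q = - (q ^ 6)" "q ^ 3 * - q = - (q ^ 4)" "q * - q = - (q\<^sup>2)"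
      "(- q) ^ 3 = - (q ^ 3)" "q ^ 6 * - (q ^ 3) = - (q ^ 9)" "q ^ 12 * - (q ^ 3) = - (q ^ 15)"
      by (simp_all add: power_numeral_reduce)
    show ?thesis
      unfolding f_def e quint_values6[OF q] Theta_values18[OF q] using q
      by (simp add: field_simps power_numeral_reduce)
  qed
  ultimately have zeros: "f x = 0" if x: "x \<noteq> 0" "g x = 0" for x
    using Theta_minus_eq_0_cases[OF q x(1)] x(2) quasi_periodic_zero[of "q\<^sup>2" f m] f m q
    unfolding g_def by (metis neg_equal_0_iff_equal power_not_zero zero_neq_one)
  have simple: "\<exists>d. d \<noteq> 0 \<and> (g has_field_derivative d) (at x)" if "x \<noteq> 0" "g x = 0" for x
    using Theta_monom_simple_zero[OF q, of "- 1" x 1] that by (simp add: g_def)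
  have hol: "f holomorphic_on -{0}" "g holomorphic_on -{0}"
    unfolding f_def g_def using q less by (auto intro!: holomorphic_intros)
  obtain c where c: "\<And>x. x \<noteq> 0 \<Longrightarrow> f x = c * g x"
    using quasi_periodic_proportional[of "q\<^sup>2" f g m] q less[of 2] hol f g m simple zeros by auto
  have "f 1 = 2 * (quint q (q ^ 6) * qpoch_inf (q ^ 6) (q ^ 6))"
    using q by (simp add: f_def quint_values6 Theta_values18 Theta_one less)
  hence "c * g 1 = 2 * (qpoch_inf (q ^ 6) (q ^ 6) * quint q (q ^ 6))"
    using c[of 1] by (simp add: mult_ac)
  moreover define \<psi> where "\<psi> = (qpoch_inf (q\<^sup>2) (q\<^sup>2))\<^sup>2 / qpoch_inf q q"
  ultimately have "c * (2 * \<psi>) = 2 * (qpoch_inf (q ^ 3) (q ^ 3) / qpoch_inf (q ^ 6) (q ^ 6) * \<psi>)"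
    unfolding g_def quint_base6[OF q] Theta_minus_one[OF q(1)] by simp
  moreover have "\<psi> \<noteq> 0"
    unfolding \<psi>_def by (rule psi_nonzero[OF q(1)])
  ultimately have "2 * \<psi> \<noteq> 0"
    and "2 * \<psi> * c = 2 * \<psi> * (qpoch_inf (q ^ 3) (q ^ 3) / qpoch_inf (q ^ 6) (q ^ 6))"
    by (simp, simp only: mult_ac)
  hence "c = qpoch_inf (q ^ 3) (q ^ 3) / qpoch_inf (q ^ 6) (q ^ 6)"
    using mult_left_cancel by blast
  thus ?thesis
    using c[OF assms(3)] by (simp add: f_def g_def)
qed

text \<open>
  Up to a common constant, each product on the left is a theta function with nome \<open>q ^ 9\<close>, and these
  two are the terms of the
  quintuple expansion with nome \<open>q ^ 3\<close>.
\<close>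

lemma Theta_pair_eq_quint:
  assumes q: "norm q < 1" "q \<noteq> 0" and z: "z \<noteq> 0"
  shows "Theta (q ^ 3 * z ^ 3) (q ^ 18) * Theta (q ^ 12 * z ^ 3) (q ^ 18)
       + z * (Theta (q ^ 6 * z ^ 3) (q ^ 18) * Theta (q ^ 15 * z ^ 3) (q ^ 18))
     = Theta (q ^ 3) (q ^ 18) * qpoch_inf (q ^ 6) (q ^ 6) * quint z (q ^ 3)"
proof -
  have less: "norm (q ^ n) < 1" if "0 < n" for n
    using that q by (simp add: norm_power power_less_one_iff)
  define a where "a = qpoch_inf (q ^ 9) (q ^ 9)"
  define b where "b = (qpoch_inf (q ^ 18) (q ^ 18))\<^sup>2"
  define c where "c = qpoch_inf (q ^ 3) (q ^ 3)"
  have nz: "a \<noteq> 0" "b \<noteq> 0" "c \<noteq> 0"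
    unfolding a_def b_def c_def using qpoch_self_nonzero[OF less] by auto
  have dis: "Theta (q ^ k * y) (q ^ 9) * b = a * (Theta (q ^ k * y) (q ^ 18) * Theta (q ^ (k + 9) * y) (q ^ 18))"
    if "y \<noteq> 0" for k y
    using Theta_dissect[OF less[of 9], of "q ^ k * y"] q that
    by (simp add: a_def b_def power_add mult_ac flip: power_mult)
  have "Theta (q ^ 3) (q ^ 9) = c"
    using Theta_cubed_base[OF less[of 3]] q by (simp add: c_def flip: power_mult)
  hence 1: "c * b = a * (Theta (q ^ 3) (q ^ 18) * qpoch_inf (q ^ 6) (q ^ 6))"
    using dis[of 1 3] Theta_values18[OF q] by simp
  have 2: "c * quint z (q ^ 3) = Theta (q ^ 3 * z ^ 3) (q ^ 9) + z * Theta (q ^ 6 * z ^ 3) (q ^ 9)"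
    using nz by (simp add: quint_def c_def flip: power_mult)
  have 3: "Theta (q ^ 3 * z ^ 3) (q ^ 9) * b = a * (Theta (q ^ 3 * z ^ 3) (q ^ 18) * Theta (q ^ 12 * z ^ 3) (q ^ 18))"
    "Theta (q ^ 6 * z ^ 3) (q ^ 9) * b = a * (Theta (q ^ 6 * z ^ 3) (q ^ 18) * Theta (q ^ 15 * z ^ 3) (q ^ 18))"
    using dis[of "z ^ 3" 3] dis[of "z ^ 3" 6] z by simp_all
  have "a * (Theta (q ^ 3 * z ^ 3) (q ^ 18) * Theta (q ^ 12 * z ^ 3) (q ^ 18)
       + z * (Theta (q ^ 6 * z ^ 3) (q ^ 18) * Theta (q ^ 15 * z ^ 3) (q ^ 18)))
     = (Theta (q ^ 3 * z ^ 3) (q ^ 9) + z * Theta (q ^ 6 * z ^ 3) (q ^ 9)) * b"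
    using 3 by algebra
  also have "\<dots> = (c * b) * quint z (q ^ 3)"
    using 2 by algebra
  finally show ?thesis
    using nz unfolding 1 by simp
qed

text \<open>
  Expanding the quintuple quotients on the left and using the shift relations leaves six products of theta
  functions of \<open>w = z ^ 3\<close>. Those without and those with a factor \<open>z\<close> are collapsed by the three-term relation
  at \<open>w\<close> and at \<open>1 / w\<close>, respectively.
\<close>

lemma quint_sum_eq_quint:
  assumes q: "norm q < 1" "q \<noteq> 0" and z: "z \<noteq> 0"
  shows "quint z (q ^ 6) * Theta (q ^ 9 * z ^ 3) (q ^ 18)
      + q * quint (q\<^sup>2 * z) (q ^ 6) * Theta (q ^ 3 * z ^ 3) (q ^ 18)
      - q ^ 3 * z ^ 3 * quint (q ^ 4 * z) (q ^ 6) * Theta (q ^ 15 * z ^ 3) (q ^ 18)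
    = quint q (q ^ 6) * qpoch_inf (q ^ 6) (q ^ 6) * quint z (q ^ 3)" (is "?L = ?R")
proof -
  have less: "norm (q ^ n) < 1" if "0 < n" for n
    using that q by (simp add: norm_power power_less_one_iff)
  define E where "E = qpoch_inf (q ^ 6) (q ^ 6)"
  define w where "w = z ^ 3"
  define T where "T = (\<lambda>j. Theta (q ^ j * w) (q ^ 18))"
  define T3 where "T3 = Theta (q ^ 3) (q ^ 18)"
  define T9 where "T9 = Theta (q ^ 9) (q ^ 18)"
  have w: "w \<noteq> 0" using z by (simp add: w_def)
  have E: "E \<noteq> 0"
    using qpoch_self_nonzero[OF less[of 6]] by (simp add: E_def)
  have ex: "quint (q ^ k * z) (q ^ 6) * E = T (3 * k + 6) + q ^ k * z * T (3 * k + 12)" for k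
    using quint_expand6[OF q, of "q ^ k * z"]
    by (simp add: E_def T_def w_def power_mult_distrib mult_ac power_add flip: power_mult)
  have T18: "T 18 = - T 0 / w" and T24: "T 24 = - T 6 / (q ^ 6 * w)"
    using Theta_shift_power[OF q w, of 18 0] Theta_shift_power[OF q w, of 18 6] by (simp_all add: T_def)
  have r: "norm (q ^ 3) < 1" "q ^ 3 \<noteq> 0"
    using less q by auto
  have W: "T3 * (Theta (q ^ 6 * y) (q ^ 18) * Theta (q ^ 9 * y) (q ^ 18)
        + q ^ 3 * (Theta y (q ^ 18) * Theta (q ^ 15 * y) (q ^ 18)))
      = T9 * (Theta (q ^ 3 * y) (q ^ 18) * Theta (q ^ 12 * y) (q ^ 18))" if "y \<noteq> 0" for y
    using Theta_three_term[OF r that] by (simp add: T3_def T9_def flip: power_mult)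
  have W1: "T3 * (T 6 * T 9 + q ^ 3 * (T 0 * T 15)) = T9 * (T 3 * T 12)"
    using W[OF w] by (simp add: T_def)
  have refl: "Theta (q ^ (18 - j) * (1 / w)) (q ^ 18) = T j" if "j \<le> 18" for j
    using Theta_reflect_power[OF q(2) that, of w] by (simp add: T_def)
  have inv: "Theta (1 / w) (q ^ 18) = - T 0 / w"
    using Theta_inverse[of "q ^ 18" w] less q w by (simp add: T_def)
  \<comment> \<open>The relation at \<open>1 / w\<close>, written in terms of \<open>w\<close> by reflection.\<close>
  have W2: "T3 * (T 12 * T 9 - q ^ 3 / w * (T 0 * T 3)) = T9 * (T 15 * T 6)"
    using W[of "1 / w"] refl[of 3] refl[of 6] refl[of 9] refl[of 12] refl[of 15] inv w by simp
  \<comment> \<open>A factor of a non-vanishing product, by the dissection of \<open>Theta (q ^ 3) (q ^ 9) = (q ^ 3; q ^ 3)\<close>.\<close>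
  have T3: "T3 \<noteq> 0"
  proof -
    have "q ^ 18 = (q ^ 9)\<^sup>2" "(q ^ 3) ^ 3 = q ^ 9"
      by (simp_all flip: power_mult)
    moreover have "q ^ 3 \<noteq> 0" "q ^ 9 \<noteq> 0"
      using q by auto
    ultimately show ?thesis
      using Theta_dissect[OF less[of 9], of "q ^ 3"] Theta_cubed_base[OF less[of 3]]
        qpoch_self_nonzero[OF less[of 18]] qpoch_self_nonzero[OF less[of 3]]
      by (auto simp: T3_def)
  qed
  have K: "quint q (q ^ 6) * E = T9 + q * T3"
    using Theta_sum_eq_quint[OF q] by (simp add: T3_def T9_def E_def)
  have P: "T 3 * T 12 + z * (T 6 * T 15) = T3 * E * quint z (q ^ 3)"
    using Theta_pair_eq_quint[OF q z] by (simp add: T_def T3_def E_def w_def)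
  have ex0: "quint z (q ^ 6) * E = T 6 + z * T 12"
    and ex2: "quint (q\<^sup>2 * z) (q ^ 6) * E = T 12 + q\<^sup>2 * z * T 18"
    and ex4: "quint (q ^ 4 * z) (q ^ 6) * E = T 18 + q ^ 4 * z * T 24"
    using ex[of 0] ex[of 2] ex[of 4] by simp_all
  have L: "?L = quint z (q ^ 6) * T 9 + q * quint (q\<^sup>2 * z) (q ^ 6) * T 3
      - q ^ 3 * w * quint (q ^ 4 * z) (q ^ 6) * T 15"
    by (simp add: T_def w_def)
  have "(E * T3) * ?L = T3 * ((quint z (q ^ 6) * E) * T 9 + q * (quint (q\<^sup>2 * z) (q ^ 6) * E) * T 3
      - q ^ 3 * w * (quint (q ^ 4 * z) (q ^ 6) * E) * T 15)"
    unfolding L by (simp add: algebra_simps)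
  also have "\<dots> = T3 * ((T 6 + z * T 12) * T 9 + q * (T 12 + q\<^sup>2 * z * T 18) * T 3
      - q ^ 3 * w * (T 18 + q ^ 4 * z * T 24) * T 15)"
    unfolding ex0 ex2 ex4 ..
  also have "\<dots> = T3 * (T 6 * T 9 + q ^ 3 * (T 0 * T 15)) + z * (T3 * (T 12 * T 9 - q ^ 3 / w * (T 0 * T 3)))
       + q * T3 * (T 3 * T 12 + z * (T 6 * T 15))"
    unfolding T18 T24 using q w by (simp add: field_simps power_numeral_reduce)
  also have "\<dots> = (T9 + q * T3) * (T 3 * T 12 + z * (T 6 * T 15))"
    unfolding W1 W2 by (simp add: algebra_simps)
  also have "\<dots> = (E * T3) * ?R"
    unfolding K [symmetric] P by (simp add: E_def)
  finally show ?thesis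
    using E T3 by simp
qed

text \<open>
  Again \<open>u \<mapsto> q\<^sup>2 u\<close> permutes the summands cyclically. Modulo powers of \<open>q\<^sup>2\<close>, the right-hand side vanishes at
  \<open>-1\<close>, \<open>-q\<close> and the three cube roots of unity. The constant is read off at \<open>u = q\<close>, where the
  first summand vanishes and each of the others reduces to \<open>quint q (q ^ 6)\<close> times an Euler product.
\<close>

lemma quint_at_square_sum_eq_Theta_mult:
  assumes q: "norm q < 1" "q \<noteq> 0" and "u \<noteq> 0"
  shows "- (u ^ 3) * quint (q * u\<^sup>2) (q ^ 6) * Theta (q ^ 15 * u ^ 3) (q ^ 18)
      - u ^ 4 * quint (q ^ 3 * u\<^sup>2) (q ^ 6) * Theta (q ^ 9 * u ^ 3) (q ^ 18)
      - q ^ 4 * u ^ 5 * quint (q ^ 5 * u\<^sup>2) (q ^ 6) * Theta (q ^ 3 * u ^ 3) (q ^ 18)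
    = Theta (- u) q * Theta (u ^ 3) (q ^ 6) / qpoch_inf (q ^ 3) (q ^ 3)"
proof -
  define f where "f = (\<lambda>u. - (u ^ 3) * quint (q * u\<^sup>2) (q ^ 6) * Theta (q ^ 15 * u ^ 3) (q ^ 18)
      - u ^ 4 * quint (q ^ 3 * u\<^sup>2) (q ^ 6) * Theta (q ^ 9 * u ^ 3) (q ^ 18)
      - q ^ 4 * u ^ 5 * quint (q ^ 5 * u\<^sup>2) (q ^ 6) * Theta (q ^ 3 * u ^ 3) (q ^ 18))"
  define g where "g = (\<lambda>u. Theta (- u) q * Theta (u ^ 3) (q ^ 6))"
  define m where "m = (\<lambda>u. - 1 / (q * u ^ 5))"
  have less: "norm (q ^ n) < 1" if "0 < n" for n
    using that q by (simp add: norm_power power_less_one_iff)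
  have f: "f (q\<^sup>2 * u) = m u * f u" if u: "u \<noteq> 0" for u
  proof -
    have e: "(q\<^sup>2 * u) ^ 3 = q ^ 6 * u ^ 3" "(q\<^sup>2 * u)\<^sup>2 = q ^ 4 * u\<^sup>2"
      "q * (q ^ 4 * u\<^sup>2) = q ^ 5 * u\<^sup>2" "q ^ 3 * (q ^ 4 * u\<^sup>2) = q ^ 7 * u\<^sup>2"
      "q ^ 5 * (q ^ 4 * u\<^sup>2) = q ^ 9 * u\<^sup>2"
      "q ^ 15 * (q ^ 6 * u ^ 3) = q ^ 21 * u ^ 3" "q ^ 9 * (q ^ 6 * u ^ 3) = q ^ 15 * u ^ 3"
      "q ^ 3 * (q ^ 6 * u ^ 3) = q ^ 9 * u ^ 3"
      by (simp_all add: power_mult_distrib power_numeral_reduce)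
    have "quint (q ^ 7 * u\<^sup>2) (q ^ 6) = - quint (q * u\<^sup>2) (q ^ 6) / (q ^ 9 * u ^ 6)"
      "quint (q ^ 9 * u\<^sup>2) (q ^ 6) = - quint (q ^ 3 * u\<^sup>2) (q ^ 6) / (q ^ 15 * u ^ 6)"
      using quint_shift6[OF q, of "u\<^sup>2" 1] quint_shift6[OF q, of "u\<^sup>2" 3] u by (simp_all flip: power_mult)
    moreover have "Theta (q ^ 21 * u ^ 3) (q ^ 18) = - Theta (q ^ 3 * u ^ 3) (q ^ 18) / (q ^ 3 * u ^ 3)"
      using Theta_shift_power[OF q, of "u ^ 3" 18 3] u by simp
    ultimately show ?thesis
      unfolding f_def m_def e using q u by (simp only:) (simp add: field_simps power_numeral_reduce)
  qed
  have g: "g (q\<^sup>2 * u) = m u * g u" if u: "u \<noteq> 0" for u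
  proof -
    have e: "(q\<^sup>2 * u) ^ 3 = q ^ 6 * u ^ 3" "- (q\<^sup>2 * u) = q * (q * - u)"
      by (simp_all add: power_mult_distrib power_numeral_reduce)
    have "Theta (q * (q * - u)) q = Theta (- u) q / (q * u\<^sup>2)"
      using Theta_shift[OF q, of "q * - u"] Theta_shift[OF q, of "- u"] q u
      by (simp add: power2_eq_square)
    moreover have "Theta (q ^ 6 * u ^ 3) (q ^ 6) = - Theta (u ^ 3) (q ^ 6) / u ^ 3"
      using Theta_shift[OF less[of 6], of "u ^ 3"] q u by simp
    ultimately show ?thesis
      unfolding g_def m_def e using q u by (simp only:) (simp add: field_simps power_numeral_reduce)
  qed
  have m: "m u \<noteq> 0" if "u \<noteq> 0" for u
    using q that by (simp add: m_def)
  have q2: "q\<^sup>2 \<noteq> 0" using q by simp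
  have spread: "f (a * (q\<^sup>2) powi k) = 0" if "a \<noteq> 0" "f a = 0" for a k
    using quasi_periodic_zero[of "q\<^sup>2" f m a k] q2 f m that by blast
  have f1: "f (- 1) = 0"
    using q by (simp add: f_def quint_values6 Theta_values18 field_simps)
  have f2: "f (- q) = 0"
  proof -
    have e: "(- q)\<^sup>2 = q\<^sup>2" "q ^ 5 * q\<^sup>2 = q ^ 7" "q ^ 3 * q\<^sup>2 = q ^ 5" "q * q\<^sup>2 = q ^ 3"
      "(- q) ^ 3 = - (q ^ 3)" "q ^ 9 * - (q ^ 3) = - (q ^ 12)" "q ^ 3 * - (q ^ 3) = - (q ^ 6)"
      by (simp_all add: power_numeral_reduce)
    show ?thesis
      unfolding f_def e quint_values6[OF q] Theta_values18[OF q] using q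
      by (simp add: field_simps power_numeral_reduce)
  qed
  have f3: "f \<zeta> = 0" if \<zeta>: "\<zeta> ^ 3 = 1" for \<zeta>
  proof -
    have e: "\<zeta> ^ 4 = \<zeta>" "\<zeta> ^ 5 = \<zeta>\<^sup>2" "(\<zeta>\<^sup>2) ^ 3 = 1"
      using \<zeta> by algebra+
    show ?thesis
      unfolding f_def e \<zeta> quint_cube_root[OF q e(3)] using q qpoch_self_nonzero[OF less[of 6]]
      by (simp add: Theta_values18[OF q] field_simps) (use \<zeta> in algebra)
  qed
  have zeros: "f u = 0" if u: "u \<noteq> 0" "g u = 0" for u
  proof (cases "Theta (- u) q = 0")
    case True
    from Theta_minus_eq_0_cases[OF q u(1) this] show ?thesis
      using spread[OF _ f1] spread[OF _ f2] q by (metis neg_equal_0_iff_equal zero_neq_one)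
  next
    case False
    hence "Theta (u ^ 3) (q ^ 6) = 0" using u by (simp add: g_def)
    from Theta_cube_eq_0_cases[OF q u(1) this] obtain \<zeta> k where "\<zeta> ^ 3 = 1" "u = \<zeta> * (q\<^sup>2) powi k" .
    thus ?thesis
      using spread[OF _ f3[of \<zeta>], of k] u by auto
  qed
  have hol: "(\<lambda>u. Theta (- u) q) holomorphic_on -{0}" "(\<lambda>u. Theta (u ^ 3) (q ^ 6)) holomorphic_on -{0}"
    using q less by (auto intro!: holomorphic_intros)
  have simple: "\<exists>d. d \<noteq> 0 \<and> (g has_field_derivative d) (at u)" if u: "u \<noteq> 0" "g u = 0" for u
  proof (cases "Theta (- u) q = 0")
    case True
    show ?thesis
      unfolding g_def
      by (rule simple_zero_mult(1)) (use Theta_monom_simple_zero[OF q, of "- 1" u 1] True u hol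
        Theta_zeros_disjoint[OF q u(1) True] in auto)
  next
    case False
    moreover from this have "Theta (u ^ 3) (q ^ 6) = 0" using u by (simp add: g_def)
    ultimately show ?thesis
      unfolding g_def
      by (intro simple_zero_mult(2)) (use Theta_monom_simple_zero[OF less[of 6], of 1 u 3] q u hol in auto)
  qed
  have hol_f: "f holomorphic_on -{0}"
    unfolding f_def using q less by (auto intro!: holomorphic_intros)
  have hol_g: "g holomorphic_on -{0}"
    unfolding g_def by (intro holomorphic_on_mult hol)
  obtain c where c: "\<And>u. u \<noteq> 0 \<Longrightarrow> f u = c * g u"
    using quasi_periodic_proportional[of "q\<^sup>2" f g m] q less[of 2] hol_f hol_g f g m simple zeros by auto
  define \<psi> where "\<psi> = (qpoch_inf (q\<^sup>2) (q\<^sup>2))\<^sup>2 / qpoch_inf q q"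
  define E where "E = qpoch_inf (q ^ 6) (q ^ 6)"
  define D where "D = qpoch_inf (q ^ 3) (q ^ 3)"
  have nz: "\<psi> \<noteq> 0" "E \<noteq> 0" "D \<noteq> 0"
    using psi_nonzero[OF q(1)] qpoch_self_nonzero[OF less] by (auto simp: \<psi>_def E_def D_def)
  have "f q = 2 * (E * quint q (q ^ 6))"
  proof -
    have e: "q ^ 5 * q\<^sup>2 = q ^ 7" "q ^ 3 * q\<^sup>2 = q ^ 5" "q * q\<^sup>2 = q ^ 3"
      "q ^ 9 * q ^ 3 = q ^ 12" "q ^ 3 * q ^ 3 = q ^ 6"
      by (simp_all add: power_numeral_reduce)
    show ?thesis
      unfolding f_def e quint_values6[OF q] Theta_values18[OF q] E_def [symmetric] using q
      by (simp add: field_simps power_numeral_reduce)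
  qed
  also have "\<dots> = 2 * (D / E * \<psi>)"
    using quint_base6[OF q] by (simp add: E_def D_def \<psi>_def)
  finally have "c * g q = 2 * (D / E * \<psi>)"
    using c[OF q(2)] by simp
  moreover have "g q = 2 * \<psi> * (D\<^sup>2 / E)"
  proof -
    have "Theta (- q) q = 2 * \<psi>"
      using Theta_shift[OF q, of "- 1"] Theta_minus_one[OF q(1)] by (simp add: \<psi>_def)
    moreover have "Theta (q ^ 3) (q ^ 6) = D\<^sup>2 / E"
      using Theta_base_square[OF less[of 3]] q by (simp add: D_def E_def flip: power_mult)
    ultimately show ?thesis by (simp add: g_def)
  qed
  ultimately have "c = 1 / D"
    using nz by (simp add: field_simps power2_eq_square)
  thus ?thesis
    using c[OF assms(3)] by (simp add: f_def g_def D_def)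
qed

text \<open>
  Again \<open>z \<mapsto> q\<^sup>2 z\<close> permutes the summands cyclically. Modulo powers of \<open>q\<^sup>2\<close>, the right-hand side vanishes at
  \<open>-1\<close>, \<open>-q\<close> and the numbers \<open>q \<zeta>\<close> with \<open>\<zeta> ^ 3 = 1\<close>. At \<open>z = 1\<close> the left-hand side is twice the
  expansion of \<open>quint q (q ^ 6)\<close>, which gives the constant.
\<close>

lemma quint_sum_eq_Theta_mult:
  assumes q: "norm q < 1" "q \<noteq> 0" and "z \<noteq> 0"
  shows "quint z (q ^ 6) * Theta (q ^ 9 * z ^ 6) (q ^ 18)
      + q / z * quint (q\<^sup>2 * z) (q ^ 6) * Theta (q ^ 3 * z ^ 6) (q ^ 18)
      - q ^ 3 * z ^ 4 * quint (q ^ 4 * z) (q ^ 6) * Theta (q ^ 15 * z ^ 6) (q ^ 18)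
    = Theta (- z) q * Theta (q ^ 3 * z ^ 3) (q ^ 6) / qpoch_inf (q ^ 3) (q ^ 3)"
proof -
  define f where "f = (\<lambda>z. quint z (q ^ 6) * Theta (q ^ 9 * z ^ 6) (q ^ 18)
      + q / z * quint (q\<^sup>2 * z) (q ^ 6) * Theta (q ^ 3 * z ^ 6) (q ^ 18)
      - q ^ 3 * z ^ 4 * quint (q ^ 4 * z) (q ^ 6) * Theta (q ^ 15 * z ^ 6) (q ^ 18))"
  define g where "g = (\<lambda>z. Theta (- z) q * Theta (q ^ 3 * z ^ 3) (q ^ 6))"
  define m where "m = (\<lambda>z. - 1 / (q ^ 4 * z ^ 5))"
  have less: "norm (q ^ n) < 1" if "0 < n" for n
    using that q by (simp add: norm_power power_less_one_iff)
  have f: "f (q\<^sup>2 * z) = m z * f z" if z: "z \<noteq> 0" for z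
  proof -
    have e: "(q\<^sup>2 * z) ^ 6 = q ^ 12 * z ^ 6" "q\<^sup>2 * (q\<^sup>2 * z) = q ^ 4 * z" "q ^ 4 * (q\<^sup>2 * z) = q ^ 6 * z"
      "q ^ 9 * (q ^ 12 * z ^ 6) = q ^ 21 * z ^ 6" "q ^ 3 * (q ^ 12 * z ^ 6) = q ^ 15 * z ^ 6"
      "q ^ 15 * (q ^ 12 * z ^ 6) = q ^ 27 * z ^ 6"
      by (simp_all add: power_mult_distrib power_numeral_reduce)
    have "quint (q ^ 6 * z) (q ^ 6) = - quint z (q ^ 6) / (q ^ 6 * z ^ 3)"
      using quint_shift6[OF q z, of 0] by simp
    moreover have "Theta (q ^ 21 * z ^ 6) (q ^ 18) = - Theta (q ^ 3 * z ^ 6) (q ^ 18) / (q ^ 3 * z ^ 6)"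
      "Theta (q ^ 27 * z ^ 6) (q ^ 18) = - Theta (q ^ 9 * z ^ 6) (q ^ 18) / (q ^ 9 * z ^ 6)"
      using Theta_shift_power[OF q, of "z ^ 6" 18 3] Theta_shift_power[OF q, of "z ^ 6" 18 9] z by simp_all
    ultimately show ?thesis
      unfolding f_def m_def e using q z by (simp only:) (simp add: field_simps power_numeral_reduce)
  qed
  have g: "g (q\<^sup>2 * z) = m z * g z" if z: "z \<noteq> 0" for z
  proof -
    have e: "q ^ 3 * (q\<^sup>2 * z) ^ 3 = q ^ 6 * (q ^ 3 * z ^ 3)" "- (q\<^sup>2 * z) = q * (q * - z)"
      by (simp_all add: power_mult_distrib power_numeral_reduce)
    have "Theta (q * (q * - z)) q = Theta (- z) q / (q * z\<^sup>2)"
      using Theta_shift[OF q, of "q * - z"] Theta_shift[OF q, of "- z"] q z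
      by (simp add: power2_eq_square)
    moreover have "Theta (q ^ 6 * (q ^ 3 * z ^ 3)) (q ^ 6) = - Theta (q ^ 3 * z ^ 3) (q ^ 6) / (q ^ 3 * z ^ 3)"
      using Theta_shift[OF less[of 6], of "q ^ 3 * z ^ 3"] q z by simp
    ultimately show ?thesis
      unfolding g_def m_def e using q z by (simp only:) (simp add: field_simps power_numeral_reduce)
  qed
  have m: "m z \<noteq> 0" if "z \<noteq> 0" for z
    using q that by (simp add: m_def)
  have q2: "q\<^sup>2 \<noteq> 0" using q by simp
  have spread: "f (a * (q\<^sup>2) powi k) = 0" if "a \<noteq> 0" "f a = 0" for a k
    using quasi_periodic_zero[of "q\<^sup>2" f m a k] q2 f m that by blast
  have f1: "f (- 1) = 0"
  proof -
    have e: "q\<^sup>2 * - 1 = - (q\<^sup>2)" "q ^ 4 * - 1 = - (q ^ 4)" "(- 1 :: complex) ^ 6 = 1"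
      "(- 1 :: complex) ^ 4 = 1" "q / - 1 = - q"
      by simp_all
    have "quint (- 1) (q ^ 6) = 0"
      using q by (intro quint_minus_one) simp
    thus ?thesis
      unfolding f_def e mult_1_right quint_values6[OF q] Theta_values18[OF q] using q
      by (simp add: field_simps power_numeral_reduce)
  qed
  have f2: "f (- q) = 0"
  proof -
    have e: "(- q) ^ 6 = q ^ 6" "q\<^sup>2 * - q = - (q ^ 3)" "q ^ 4 * - q = - (q ^ 5)"
      "q ^ 9 * q ^ 6 = q ^ 15" "q ^ 15 * q ^ 6 = q ^ 21"
      by (simp_all add: power_numeral_reduce)
    show ?thesis
      unfolding f_def e quint_values6[OF q] Theta_values18[OF q] using q
      by (simp add: field_simps power_numeral_reduce)
  qed
  have f3: "f (q * \<zeta>) = 0" if \<zeta>: "\<zeta> ^ 3 = 1" for \<zeta>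
  proof -
    have \<zeta>6: "\<zeta> ^ 6 = 1" and \<zeta>4: "\<zeta> ^ 4 = \<zeta>"
      using \<zeta> by algebra+
    have "\<zeta> \<noteq> 0" using \<zeta> by auto
    hence inv: "q / (q * \<zeta>) = \<zeta>\<^sup>2"
      using \<zeta> q by (simp add: field_simps power_numeral_reduce)
    have e: "(q * \<zeta>) ^ 6 = q ^ 6" "(q * \<zeta>) ^ 4 = q ^ 4 * \<zeta>" "q\<^sup>2 * (q * \<zeta>) = q ^ 3 * \<zeta>"
      "q ^ 4 * (q * \<zeta>) = q ^ 5 * \<zeta>" "q ^ 9 * q ^ 6 = q ^ 15" "q ^ 15 * q ^ 6 = q ^ 21" "q ^ 3 * q ^ 6 = q ^ 9"
      by (simp_all add: power_mult_distrib \<zeta>6 \<zeta>4) (simp_all add: power_numeral_reduce)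
    show ?thesis
      unfolding f_def e inv quint_cube_root[OF q \<zeta>] Theta_values18[OF q] using q qpoch_self_nonzero[OF less[of 6]]
      by (simp add: field_simps) (use \<zeta> in algebra)
  qed
  have zeros: "f z = 0" if z: "z \<noteq> 0" "g z = 0" for z
  proof (cases "Theta (- z) q = 0")
    case True
    from Theta_minus_eq_0_cases[OF q z(1) this] show ?thesis
      using spread[OF _ f1] spread[OF _ f2] q by (metis neg_equal_0_iff_equal zero_neq_one)
  next
    case False
    hence "Theta ((q * z) ^ 3) (q ^ 6) = 0" using z by (simp add: g_def power_mult_distrib)
    with q z obtain \<zeta> k where \<zeta>: "\<zeta> ^ 3 = 1" "q * z = \<zeta> * (q\<^sup>2) powi k"
      using Theta_cube_eq_0_cases[OF q, of "q * z"] by auto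
    have "z = q * \<zeta> * (q\<^sup>2) powi (k - 1)"
      using \<zeta>(2) q by (simp add: power_int_diff field_simps power2_eq_square)
    moreover have "\<zeta> \<noteq> 0" using \<zeta> by auto
    ultimately show ?thesis
      using spread[OF _ f3[OF \<zeta>(1)], of "k - 1"] q by auto
  qed
  have hol: "(\<lambda>z. Theta (- z) q) holomorphic_on -{0}"
    "(\<lambda>z. Theta (q ^ 3 * z ^ 3) (q ^ 6)) holomorphic_on -{0}"
    using q less by (auto intro!: holomorphic_intros)
  have simple: "\<exists>d. d \<noteq> 0 \<and> (g has_field_derivative d) (at z)" if z: "z \<noteq> 0" "g z = 0" for z
  proof (cases "Theta (- z) q = 0")
    case True
    have "Theta (- (q * z)) q = 0"
      using Theta_shift[OF q, of "- z"] True z by simp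
    hence "Theta (q ^ 3 * z ^ 3) (q ^ 6) \<noteq> 0"
      using Theta_zeros_disjoint[OF q, of "q * z"] q z by (simp add: power_mult_distrib)
    thus ?thesis
      unfolding g_def
      by (intro simple_zero_mult(1)) (use Theta_monom_simple_zero[OF q, of "- 1" z 1] True z hol in auto)
  next
    case False
    moreover from this have "Theta (q ^ 3 * z ^ 3) (q ^ 6) = 0" using z by (simp add: g_def)
    ultimately show ?thesis
      unfolding g_def
      by (intro simple_zero_mult(2)) (use Theta_monom_simple_zero[OF less[of 6], of "q ^ 3" z 3] q z hol in auto)
  qed
  have hol_f: "f holomorphic_on -{0}"
    unfolding f_def using q less by (auto intro!: holomorphic_intros)
  have hol_g: "g holomorphic_on -{0}"
    unfolding g_def by (intro holomorphic_on_mult hol)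
  obtain c where c: "\<And>z. z \<noteq> 0 \<Longrightarrow> f z = c * g z"
    using quasi_periodic_proportional[of "q\<^sup>2" f g m] q less[of 2] hol_f hol_g f g m simple zeros by auto
  define \<psi> where "\<psi> = (qpoch_inf (q\<^sup>2) (q\<^sup>2))\<^sup>2 / qpoch_inf q q"
  define E where "E = qpoch_inf (q ^ 6) (q ^ 6)"
  define D where "D = qpoch_inf (q ^ 3) (q ^ 3)"
  have nz: "\<psi> \<noteq> 0" "E \<noteq> 0" "D \<noteq> 0"
    using psi_nonzero[OF q(1)] qpoch_self_nonzero[OF less] by (auto simp: \<psi>_def E_def D_def)
  have quint1: "quint 1 (q ^ 6) = 2" and quint2: "quint (q\<^sup>2) (q ^ 6) = 1"
    and quint4: "quint (q ^ 4) (q ^ 6) = - 1 / q\<^sup>2"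
  proof -
    show "quint 1 (q ^ 6) = 2"
      using quint_expand6[OF q, of 1] nz by (simp add: Theta_values18[OF q] E_def)
    have "Theta (q ^ 18) (q ^ 18) = 0"
      using Theta_reflect[of "q ^ 18" 1] Theta_one[OF less[of 18]] q by simp
    thus "quint (q\<^sup>2) (q ^ 6) = 1"
      using quint_expand6[OF q, of "q\<^sup>2"] nz q by (simp add: Theta_values18[OF q] E_def flip: power_mult power_add)
    have "q ^ 6 / q\<^sup>2 = q ^ 4"
      using q by (simp add: power_numeral_reduce)
    with \<open>quint (q\<^sup>2) (q ^ 6) = 1\<close> show "quint (q ^ 4) (q ^ 6) = - 1 / q\<^sup>2"
      using quint_reflect[OF less[of 6], of "q\<^sup>2"] q by (simp add: field_simps power_numeral_reduce)
  qed
  have "f 1 = 2 * (quint q (q ^ 6) * E)"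
    unfolding E_def Theta_sum_eq_quint[OF q, symmetric]
      f_def power_one mult_1_right quint1 quint2 quint4 Theta_values18[OF q]
    using q by (simp add: field_simps power_numeral_reduce)
  also have "\<dots> = 2 * (D / E * \<psi>)"
    using quint_base6[OF q] by (simp add: E_def D_def \<psi>_def mult.commute)
  finally have "c * g 1 = 2 * (D / E * \<psi>)"
    using c[of 1] by simp
  moreover have "g 1 = 2 * \<psi> * (D\<^sup>2 / E)"
  proof -
    have "Theta (- 1) q = 2 * \<psi>"
      using Theta_minus_one[OF q(1)] by (simp add: \<psi>_def)
    moreover have "Theta (q ^ 3) (q ^ 6) = D\<^sup>2 / E"
      using Theta_base_square[OF less[of 3]] q by (simp add: D_def E_def flip: power_mult)
    ultimately show ?thesis by (simp add: g_def)
  qed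
  ultimately have "c = 1 / D"
    using nz by (simp add: field_simps power2_eq_square)
  thus ?thesis
    using c[OF assms(3)] by (simp add: f_def g_def D_def)
qed

section \<open>Removing the denominators\<close>

theorem theorem9p2:
  fixes q x z u :: complex
  assumes "0 < norm q" and "norm q < 1"
    and "x \<noteq> 0" and "z \<noteq> 0" and "u \<noteq> 0"
  shows
    "(Theta (q * z) (q^6) \<noteq> 0 \<and> Theta (q^3 * z) (q^6) \<noteq> 0 \<and> Theta (q^5 * z) (q^6) \<noteq> 0 \<longrightarrow>
        z * (Theta (q^2 * z^2) (q^6) * Theta (q^3) (q^18) / Theta (q * z) (q^6))
        - Theta (z^2) (q^6) * Theta (q^9) (q^18) / Theta (q^3 * z) (q^6)
        - z * (Theta (q^4 * z^2) (q^6) * Theta (q^3) (q^18) / Theta (q^5 * z) (q^6))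
      = - (qpoch_inf (q^3) (q^3) * Theta (z^2) (q^6)
            / (Theta (q^3 * z) (q^6) * qpoch_inf (q^6) (q^6)))
          * ((qpoch_inf (q^2) (q^2))^2 / qpoch_inf q q))
   \<and> (Theta (q^5 * x) (q^6) \<noteq> 0 \<and> Theta (q^3 * x) (q^6) \<noteq> 0 \<and> Theta (q * x) (q^6) \<noteq> 0 \<longrightarrow>
        Theta (q^4 * x^2) (q^6) * Theta (q^6 * x^3) (q^18) / Theta (q^5 * x) (q^6)
        + x powi (-2) * q^3 * (Theta (x^2) (q^6) * Theta (x^3) (q^18) / Theta (q^3 * x) (q^6))
        + x * (Theta (q^2 * x^2) (q^6) * Theta (q^12 * x^3) (q^18) / Theta (q * x) (q^6))
      = qpoch_inf (q^3) (q^3) * Theta (- x) q / qpoch_inf (q^6) (q^6))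
   \<and> (Theta z (q^6) \<noteq> 0 \<and> Theta (q^2 * z) (q^6) \<noteq> 0 \<and> Theta (q^4 * z) (q^6) \<noteq> 0
        \<and> Theta z (q^3) \<noteq> 0 \<longrightarrow>
        Theta (z^2) (q^6) * Theta (q^9 * z^3) (q^18) / Theta z (q^6)
        + q * (Theta (q^4 * z^2) (q^6) * Theta (q^3 * z^3) (q^18) / Theta (q^2 * z) (q^6))
        + q * z * (Theta (q^2 * z^2) (q^6) * Theta (q^15 * z^3) (q^18) / Theta (q^4 * z) (q^6))
      = Theta (- q) (q^4) * qpoch_inf (q^3) (q^3) * Theta (z^2) (q^3)
          / (Theta z (q^3) * qpoch_inf (q^6) (q^6)))
   \<and> (Theta (q * u^2) (q^6) \<noteq> 0 \<and> Theta (q^3 * u^2) (q^6) \<noteq> 0 \<and> Theta (q^5 * u^2) (q^6) \<noteq> 0 \<longrightarrow>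
        - (u^3) * (Theta (q^2 * u^4) (q^6) * Theta (q^15 * u^3) (q^18) / Theta (q * u^2) (q^6))
        + Theta (u^4) (q^6) * Theta (q^9 * u^3) (q^18) / Theta (q^3 * u^2) (q^6)
        + u * (Theta (q^4 * u^4) (q^6) * Theta (q^3 * u^3) (q^18) / Theta (q^5 * u^2) (q^6))
      = Theta (- u) q * Theta (u^3) (q^6) / qpoch_inf (q^3) (q^3))
   \<and> (Theta z (q^6) \<noteq> 0 \<and> Theta (q^2 * z) (q^6) \<noteq> 0 \<and> Theta (q^4 * z) (q^6) \<noteq> 0 \<longrightarrow>
        Theta (z^2) (q^6) * Theta (q^9 * z^6) (q^18) / Theta z (q^6)
        + q * z powi (-1) * (Theta (q^4 * z^2) (q^6) * Theta (q^3 * z^6) (q^18) / Theta (q^2 * z) (q^6))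
        + q * z^2 * (Theta (q^2 * z^2) (q^6) * Theta (q^15 * z^6) (q^18) / Theta (q^4 * z) (q^6))
      = Theta (- z) q * Theta (q^3 * z^3) (q^6) / qpoch_inf (q^3) (q^3))"
proof -
  have q: "norm q < 1" "q \<noteq> 0"
    using assms by auto
  define E where "E = qpoch_inf (q ^ 6) (q ^ 6)"
  define D where "D = qpoch_inf (q ^ 3) (q ^ 3)"
  define \<psi> where "\<psi> = (qpoch_inf (q\<^sup>2) (q\<^sup>2))\<^sup>2 / qpoch_inf q q"
  have D\<psi>: "D / E * \<psi> = quint q (q ^ 6) * E"
    using quint_base6[OF q] by (simp add: E_def D_def \<psi>_def mult.commute)
  note quot = Theta_square_quotient_eq_quint[OF q]
  show ?thesis
  proof (intro conjI impI, goal_cases)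
    case 1
    define T3 where "T3 = Theta (q ^ 3) (q ^ 18)"
    define T9 where "T9 = Theta (q ^ 9) (q ^ 18)"
    define c where "c = quint (q ^ 3 * z) (q ^ 6)"
    from 1 have nz: "Theta (q * z) (q ^ 6) \<noteq> 0" "Theta (q ^ 3 * z) (q ^ 6) \<noteq> 0"
      "Theta (q ^ 5 * z) (q ^ 6) \<noteq> 0" by auto
    have "D * Theta (z\<^sup>2) (q ^ 6) / (Theta (q ^ 3 * z) (q ^ 6) * E)
        = D / E * (Theta (z\<^sup>2) (q ^ 6) * 1 / Theta (q ^ 3 * z) (q ^ 6))"
      by simp
    also have "\<dots> = D / E * (- (z\<^sup>2) * c)"
      unfolding quot(4)[OF assms(4) nz(2)] c_def by simp
    finally have "- (D * Theta (z\<^sup>2) (q ^ 6) / (Theta (q ^ 3 * z) (q ^ 6) * E)) * \<psi> = D / E * \<psi> * (z\<^sup>2 * c)"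
      by simp
    also have "\<dots> = (T9 + q * T3) * (z\<^sup>2 * c)"
      unfolding D\<psi> unfolding T3_def T9_def E_def Theta_sum_eq_quint[OF q] ..
    finally have rhs: "- (D * Theta (z\<^sup>2) (q ^ 6) / (Theta (q ^ 3 * z) (q ^ 6) * E)) * \<psi> = (T9 + q * T3) * (z\<^sup>2 * c)" .
    show ?case
      unfolding quot(2)[OF assms(4) nz(1)] quot(4)[OF assms(4) nz(2)] quot(6)[OF assms(4) nz(3)]
        D_def [symmetric] E_def [symmetric] \<psi>_def [symmetric] rhs T3_def [symmetric] T9_def [symmetric] c_def [symmetric]
      using quint_three_term[OF q assms(4), folded c_def] by algebra
  next
    case 2
    from 2 have nz: "Theta (q * x) (q ^ 6) \<noteq> 0" "Theta (q ^ 3 * x) (q ^ 6) \<noteq> 0"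
      "Theta (q ^ 5 * x) (q ^ 6) \<noteq> 0" by auto
    \<comment> \<open>The monomial produced by the shift of the numerator cancels the negative power.\<close>
    have xm: "x powi (- 2) * q ^ 3 * (- (x\<^sup>2) * c * t) = - (q ^ 3) * c * t" for c t
      using assms(3) by (simp add: power_int_minus field_simps)
    show ?case
      unfolding xm quot(2)[OF assms(3) nz(1)] quot(4)[OF assms(3) nz(2)] quot(6)[OF assms(3) nz(3)]
      using quint_sum_eq_Theta[OF q assms(3)] by (simp add: mult.assoc)
  next
    case 3
    from 3 have nz: "Theta z (q ^ 6) \<noteq> 0" "Theta (q\<^sup>2 * z) (q ^ 6) \<noteq> 0"
      "Theta (q ^ 4 * z) (q ^ 6) \<noteq> 0" "Theta z (q ^ 3) \<noteq> 0" by auto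
    have "Theta (z\<^sup>2) (q ^ 3) = Theta z (q ^ 3) * quint z (q ^ 3)"
      using q assms(4) by (intro Theta_square_eq_quint) (auto simp: norm_power power_less_one_iff)
    hence "Theta (- q) (q ^ 4) * D * Theta (z\<^sup>2) (q ^ 3) / (Theta z (q ^ 3) * E) = D / E * \<psi> * quint z (q ^ 3)"
      using nz(4) Theta_minus_base4[OF q] by (simp add: \<psi>_def mult_ac)
    hence rhs: "Theta (- q) (q ^ 4) * D * Theta (z\<^sup>2) (q ^ 3) / (Theta z (q ^ 3) * E)
        = quint q (q ^ 6) * E * quint z (q ^ 3)"
      unfolding D\<psi> .
    show ?case
      unfolding quot(1)[OF assms(4) nz(1)] quot(3)[OF assms(4) nz(2)] quot(5)[OF assms(4) nz(3)]
        D_def [symmetric] E_def [symmetric] rhs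
      using quint_sum_eq_quint[OF q assms(4)] by (simp add: E_def algebra_simps power_numeral_reduce)
  next
    case 4
    have u2: "u\<^sup>2 \<noteq> 0" "u ^ 4 = (u\<^sup>2)\<^sup>2"
      using assms by auto
    from 4 have nz: "Theta (q * u\<^sup>2) (q ^ 6) \<noteq> 0" "Theta (q ^ 3 * u\<^sup>2) (q ^ 6) \<noteq> 0"
      "Theta (q ^ 5 * u\<^sup>2) (q ^ 6) \<noteq> 0" by auto
    show ?case
      unfolding u2(2) quot(2)[OF u2(1) nz(1)] quot(4)[OF u2(1) nz(2)] quot(6)[OF u2(1) nz(3)]
      using quint_at_square_sum_eq_Theta_mult[OF q assms(5)] by (simp add: algebra_simps power_numeral_reduce)
  next
    case 5
    from 5 have nz: "Theta z (q ^ 6) \<noteq> 0" "Theta (q\<^sup>2 * z) (q ^ 6) \<noteq> 0"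
      "Theta (q ^ 4 * z) (q ^ 6) \<noteq> 0" by auto
    have e: "q * z powi (- 1) = q / z"
      by (simp add: power_int_minus divide_inverse)
    show ?case
      unfolding e quot(1)[OF assms(4) nz(1)] quot(3)[OF assms(4) nz(2)] quot(5)[OF assms(4) nz(3)]
      using quint_sum_eq_Theta_mult[OF q assms(4)] by (simp add: algebra_simps power_numeral_reduce)
  qed
qed

end
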